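(* Let $X$ be a nonempty compact metric space, $m\in\mathbb{N}$, let $\{T_1^q\}_{q\in\mathbb{Q}^\ast},\ldots,\{T_m^q\}_{q\in\mathbb{Q}^\ast}$ be $m$ $\mathbb{Q}^\ast$-systems of transformations of $X$, all contained in a commutative group $G$ of homeomorphisms of $X$, and let $\vec q\in\mathbb{Q}^\infty(\upsilon)$. Then there exist $x_0\in X$ and an extraction $\vec r=(r_n)_{n\in\mathbb{N}}$ of $\vec q$ such that, for every $1\le i\le m$, $$R_1\text{-}\lim_{q\in FS[(r_n(i_n,j_n))_{n\in\mathbb{N}}]}T_i^q(x_0)=x_0\qquad(\text{in particular, }T_i^{r_n(i_n,j_n)}(x_0)\to x_0),$$ uniformly for all $((i_n,j_n))_{n\in\mathbb{N}}\subseteq\mathbb{N}\times\mathbb{N}$ with $1\le i_n,j_n\le n$. Moreover, in case $(X,G)$ is minimal, the set of such points $x_0$ is a dense subset of $X$.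
   Context: Notation: $\mathbb{N}=\{1,2,\ldots\}$, $\mathbb{Z}^\ast=\mathbb{Z}\setminus\{0\}$, $\mathbb{Q}^\ast=\mathbb{Q}\setminus\{0\}$. $(X,G)$ is minimal if no nonempty proper closed subset of $X$ is invariant under $G$. "Such points $x_0$" are those for which some extraction $\vec r$ of $\vec q$ (depending on $x_0$) has the stated property. Words. $\widetilde L$ is the set of functions $w$ from a nonempty finite set $dom(w)\subset\mathbb{Z}^\ast$ to $\mathbb{N}$ with $1\le w(t)\le|t|$ for all $t\in dom(w)$. Let $\upsilon\notin\mathbb{N}$ be a symbol (variable). $dom^-(w)$, $dom^+(w)$ are the sets of negative, respectively positive, elements of $dom(w)$. $\widetilde L_0(\upsilon)$ is the set of functions $w$ from a nonempty finite $dom(w)\subset\mathbb{Z}^\ast$ to $\mathbb{N}\cup\{\upsilon\}$ with each $w(t)$ either $\upsilon$ or in $\{1,\ldots,|t|\}$, taking the value $\upsilon$ at some negative and at some positive position. For words $w,u$ with disjoint domains, $w\star u$ is the word on $dom(w)\cup dom(u)$ extending both. $w<_{R_1}u$ means $dom(u)=A_1\cup A_2$ with $A_1,A_2\neq\emptyset$ and $\max A_1<\min dom(w)\le\max dom(w)<\min A_2$. For $w\in\widetilde L_0(\upsilon)$ and $1\le a\le\min dom^+(w)$, $1\le b\le-\max dom^-(w)$, $w(a,b)$ is $w$ with $\upsilon$ replaced by $a$ at positive positions and by $b$ at negative positions; $w(\upsilon,\upsilon)=w$. Rationals as words. The map $g:\widetilde L\to\mathbb{Q}^\ast$, $g(w)=\sum_{t\in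 dom^-(w)}w(t)\frac{(-1)^{-t}}{(-t+1)!}+\sum_{t\in dom^+(w)}w(t)(-1)^{t+1}t!$, is a bijection (Budak–Işik–Pym). For $q_1,q_2\in\mathbb{Q}^\ast$, $q_1<_{R_1}q_2$ means $g^{-1}(q_1)<_{R_1}g^{-1}(q_2)$. For $w\in\widetilde L_0(\upsilon)$, $g(w)$ denotes the function $q$ with $q(i,j)=g(w(j,i))\in\mathbb{Q}^\ast$ for $1\le i\le-\max dom^-(w)$, $1\le j\le\min dom^+(w)$. Such a $q=g(w)$ is regarded as coming with its word $w$. $\mathbb{Q}^\infty(\upsilon)$ is the set of sequences $\vec q=(q_n)_{n\in\mathbb{N}}$, $q_n=g(w_n)$, with $w_n\in\widetilde L_0(\upsilon)$ and $w_n<_{R_1}w_{n+1}$ for all $n$. An extraction of $\vec q=(g(w_n))_n$ is a sequence $\vec r=(r_n)_n\in\mathbb{Q}^\infty(\upsilon)$, $r_n=g(u_n)$, with $u_n\in\widetilde L_0(\upsilon)$, $u_n<_{R_1}u_{n+1}$, and each $u_n$ of the form $w_{n_1}(a_1,b_1)\star\cdots\star w_{n_\lambda}(a_\lambda,b_\lambda)$ with $\lambda\in\mathbb{N}$, $n_1<\cdots<n_\lambda$, each $(a_l,b_l)\in\{1,\ldots,n_l\}^2\cup\{(\upsilon,\upsilon)\}$, at least one being $(\upsilon,\upsilon)$. (For $\vec r\in\mathbb{Q}^\infty(\upsilon)$, $r_n(i,j)$ is defined for $1\le i,j\le n$.) A $\mathbb{Q}^\ast$-system of $X$ is a family $\{T^q\}_{q\in\mathbb{Q}^\ast}$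 of continuous maps $X\to X$ with $T^{q_1}T^{q_2}=T^{q_1+q_2}$ whenever $q_1<_{R_1}q_2$. $FS[(x_n)_{n\in\mathbb{N}}]=\{x_{n_1}+\cdots+x_{n_\lambda}:\lambda\in\mathbb{N},n_1<\cdots<n_\lambda\}$. $R_1\text{-}\lim_{q\in D}x_q=x_0$, for $D=FS[(r_n(i_n,j_n))_n]$, means: for every neighborhood $V$ of $x_0$ there is $n_0\in\mathbb{N}$ with $x_q\in V$ for all $q\in D$ with $\min\{-\max dom^-(g^{-1}(q)),\min dom^+(g^{-1}(q))\}\ge n_0$. Uniformly means that, for each $V$, one $n_0$ works for all admissible sequences $((i_n,j_n))_n$. *)

theory Defs
  imports "HOL-Analysis.Analysis" "HOL-Algebra.Bij"
begin

section \<open>Located words\<close>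

datatype letter = Num nat | Var

text \<open>A word is a partial map with finite domain; the variable \<open>\<upsilon>\<close> is \<^const>\<open>Var\<close>.\<close>

type_synonym lword = "int \<rightharpoonup> letter"

definition dom_neg :: "lword \<Rightarrow> int set" where
  "dom_neg w = {t \<in> dom w. t < 0}"

definition dom_pos :: "lword \<Rightarrow> int set" where
  "dom_pos w = {t \<in> dom w. t > 0}"

definition Ltilde :: "lword set" where
  "Ltilde = {w. finite (dom w) \<and> dom w \<noteq> {} \<and> 0 \<notin> dom w \<and>
     (\<forall>t\<in>dom w. \<exists>k. w t = Some (Num k) \<and> 1 \<le> k \<and> int k \<le> \<bar>t\<bar>)}"

definition Ltilde0 :: "lword set" where
  "Ltilde0 = {w. finite (dom w) \<and> dom w \<noteq> {} \<and> 0 \<notin> dom w \<and>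
     (\<forall>t\<in>dom w. w t = Some Var \<or> (\<exists>k. w t = Some (Num k) \<and> 1 \<le> k \<and> int k \<le> \<bar>t\<bar>)) \<and>
     (\<exists>t\<in>dom_neg w. w t = Some Var) \<and> (\<exists>t\<in>dom_pos w. w t = Some Var)}"

definition R1_less :: "lword \<Rightarrow> lword \<Rightarrow> bool" where
  "R1_less w u \<longleftrightarrow> (\<exists>A1 A2. dom u = A1 \<union> A2 \<and> A1 \<noteq> {} \<and> A2 \<noteq> {} \<and>
     Max A1 < Min (dom w) \<and> Min (dom w) \<le> Max (dom w) \<and> Max (dom w) < Min A2)"

text \<open>\<open>subst w a b\<close> is \<open>w(a, b)\<close>: \<open>a\<close> goes to the positive and \<open>b\<close> to the negative
  positions. The letters may be \<^const>\<open>Var\<close>, so that \<open>subst w Var Var = w\<close>.\<close>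

definition subst :: "lword \<Rightarrow> letter \<Rightarrow> letter \<Rightarrow> lword" where
  "subst w a b = (\<lambda>t. if w t = Some Var then Some (if t > 0 then a else b) else w t)"

text \<open>The concatenation \<open>\<star>\<close> of words with pairwise disjoint domains.\<close>

definition star_list :: "lword list \<Rightarrow> lword" where
  "star_list ws = foldr (++) ws Map.empty"


section \<open>Rationals as words\<close>

text \<open>Only used at positions of \<open>dom w\<close> that carry a number.\<close>

definition val :: "lword \<Rightarrow> int \<Rightarrow> nat" where
  "val w t = (case w t of Some (Num k) \<Rightarrow> k | _ \<Rightarrow> 0)"

definition g :: "lword \<Rightarrow> rat" where
  "g w = (\<Sum>t\<in>dom_neg w. of_nat (val w t) * ((-1) ^ nat (-t) / fact (nat (-t + 1))))
       + (\<Sum>t\<in>dom_pos w. of_nat (val w t) * (-1) ^ nat (t + 1) * fact (nat t))"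

text \<open>By a theorem of Budak, Isik and Pym, \<^const>\<open>g\<close> is a bijection from \<^const>\<open>Ltilde\<close> onto the
  nonzero rationals; \<open>g_inv\<close> is its inverse.\<close>

definition g_inv :: "rat \<Rightarrow> lword" where
  "g_inv = inv_into Ltilde g"

definition R1_less_rat :: "rat \<Rightarrow> rat \<Rightarrow> bool" where
  "R1_less_rat q1 q2 \<longleftrightarrow> R1_less (g_inv q1) (g_inv q2)"

text \<open>The function \<open>q = g(w)\<close> of a variable word, with \<open>q(i, j) = g(w(j, i))\<close>; note the swap.\<close>

definition g_var :: "lword \<Rightarrow> nat \<Rightarrow> nat \<Rightarrow> rat" where
  "g_var w i j = g (subst w (Num j) (Num i))"

text \<open>Sequences are indexed by the positive integers; the value at index 0 is ignored throughout.
  Since \<open>q = g(w)\<close> comes with its word, a sequence \<open>(g(w\<^sub>n))\<^sub>n\<close> is given by the words \<open>w\<^sub>n\<close>.\<close>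

definition Qinf :: "(nat \<Rightarrow> lword) set" where
  "Qinf = {w. \<forall>n\<ge>1. w n \<in> Ltilde0 \<and> R1_less (w n) (w (Suc n))}"

text \<open>\<open>c n\<close> is the pair \<open>(a, b)\<close> substituted into \<open>w n\<close>; \<open>ns\<close> is the list \<open>n\<^sub>1 < \<dots> < n\<^sub>\<lambda>\<close>.\<close>

definition extraction :: "(nat \<Rightarrow> lword) \<Rightarrow> (nat \<Rightarrow> lword) \<Rightarrow> bool" where
  "extraction u w \<longleftrightarrow> u \<in> Qinf \<and>
     (\<forall>k\<ge>1. \<exists>ns c. ns \<noteq> [] \<and> sorted_wrt (<) ns \<and> (\<forall>n\<in>set ns. 1 \<le> n) \<and>
        (\<forall>n\<in>set ns. c n \<in> {(Num a, Num b) | a b. a \<in> {1..n} \<and> b \<in> {1..n}} \<union> {(Var, Var)}) \<and>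
        (\<exists>n\<in>set ns. c n = (Var, Var)) \<and>
        u k = star_list (map (\<lambda>n. subst (w n) (fst (c n)) (snd (c n))) ns))"


section \<open>Finite sums and limits\<close>

definition FS :: "(nat \<Rightarrow> rat) \<Rightarrow> rat set" where
  "FS x = {\<Sum>n\<in>F. x n | F. finite F \<and> F \<noteq> {} \<and> F \<subseteq> {1..}}"

definition admissible :: "(nat \<Rightarrow> nat \<times> nat) set" where
  "admissible = {s. \<forall>n\<ge>1. fst (s n) \<in> {1..n} \<and> snd (s n) \<in> {1..n}}"

text \<open>\<open>r\<^sub>n(i\<^sub>n, j\<^sub>n)\<close> for \<open>r\<^sub>n = g(u\<^sub>n)\<close> and \<open>s n = (i\<^sub>n, j\<^sub>n)\<close>.\<close>

definition eval_seq :: "(nat \<Rightarrow> lword) \<Rightarrow> (nat \<Rightarrow> nat \<times> nat) \<Rightarrow> nat \<Rightarrow> rat" where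
  "eval_seq u s n = g_var (u n) (fst (s n)) (snd (s n))"

text \<open>\<open>R\<^sub>1\<close>-\<open>lim\<close> of \<open>x q\<close> over \<open>q \<in> D s\<close> equals \<open>x0\<close>, uniformly in \<open>s \<in> S\<close>.\<close>

definition R1_lim_uniformly ::
    "'s set \<Rightarrow> ('s \<Rightarrow> rat set) \<Rightarrow> (rat \<Rightarrow> 'a::topological_space) \<Rightarrow> 'a \<Rightarrow> bool" where
  "R1_lim_uniformly S D x x0 \<longleftrightarrow>
     (\<forall>V. open V \<and> x0 \<in> V \<longrightarrow> (\<exists>n0\<ge>1. \<forall>s\<in>S. \<forall>q\<in>D s.
        min (- Max (dom_neg (g_inv q))) (Min (dom_pos (g_inv q))) \<ge> int n0 \<longrightarrow> x q \<in> V))"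


section \<open>Systems of transformations\<close>

definition Q_system :: "'a::topological_space set \<Rightarrow> (rat \<Rightarrow> 'a \<Rightarrow> 'a) \<Rightarrow> bool" where
  "Q_system X T \<longleftrightarrow>
     (\<forall>q. q \<noteq> 0 \<longrightarrow> continuous_on X (T q) \<and> T q \<in> X \<rightarrow> X) \<and>
     (\<forall>q1 q2. q1 \<noteq> 0 \<and> q2 \<noteq> 0 \<and> R1_less_rat q1 q2 \<longrightarrow>
        (\<forall>x\<in>X. T q1 (T q2 x) = T (q1 + q2) x))"

text \<open>Maps \<open>X \<rightarrow> X\<close> in \<open>G\<close> are extensional (undefined outside \<open>X\<close>), as in \<^const>\<open>BijGroup\<close>.\<close>

definition comm_homeo_group :: "'a::topological_space set \<Rightarrow> ('a \<Rightarrow> 'a) set \<Rightarrow> bool" where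
  "comm_homeo_group X G \<longleftrightarrow>
     subgroup G (BijGroup X) \<and> comm_group ((BijGroup X)\<lparr>carrier := G\<rparr>) \<and>
     (\<forall>f\<in>G. \<exists>h. homeomorphism X X f h)"

definition minimal_action :: "'a::topological_space set \<Rightarrow> ('a \<Rightarrow> 'a) set \<Rightarrow> bool" where
  "minimal_action X G \<longleftrightarrow>
     \<not> (\<exists>A. A \<noteq> {} \<and> A \<subset> X \<and> closedin (top_of_set X) A \<and> (\<forall>f\<in>G. f ` A \<subseteq> A))"

text \<open>The property of a point \<open>x0\<close> and an extraction \<open>(g(u\<^sub>n))\<^sub>n\<close>; the second conjunct is the
  particular case of the sequences \<open>r\<^sub>n(i\<^sub>n, j\<^sub>n)\<close> themselves.\<close>

definition recurrent_along ::
    "nat \<Rightarrow> (nat \<Rightarrow> rat \<Rightarrow> 'a::metric_space \<Rightarrow> 'a) \<Rightarrow> (nat \<Rightarrow> lword) \<Rightarrow> 'a \<Rightarrow> bool" where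
  "recurrent_along m T u x0 \<longleftrightarrow>
     (\<forall>i\<in>{1..m}.
        R1_lim_uniformly admissible (\<lambda>s. FS (eval_seq u s)) (\<lambda>q. T i q x0) x0 \<and>
        uniform_limit admissible (\<lambda>n s. T i (eval_seq u s n) x0) (\<lambda>s. x0) sequentially)"

end

(* A word u is kept variable at all its positions: u k is the concatenation of the w n for n in a finite
   set S k, the sets S k forming increasing blocks. Along nested words T^q turns concatenation into
   composition, so u k (a, b) acts as the product over n in S k of the maps of w n (a, b), all of which
   lie in the commutative group G. On a minimal set, the topological multiple recurrence theorem of
   Furstenberg and Weiss (in its version for products over finite sets of indices) yields, for the finitely many
   maps that matter at stage k, a set S k and a small open set U k with closure in U (k - 1) that all of
   them send into U (k - 1). The common point of the U k returns close to itself uniformly, because the maps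
   with larger index are applied first. A minimal subset of X exists by Zorn's lemma; if X itself is
   minimal, then U 0 can be chosen arbitrarily, which gives density.

   That g is injective on words, so that words can be read off from rational numbers, follows from
   divisibility at the lowest position at which two digit expansions differ. *)

theory Submission
  imports Defs "HOL-Algebra.FiniteProduct"
begin

section \<open>The digit expansion of rationals\<close>

text \<open>The place value of a digit, one formula for both signs, so that \<open>g\<close> becomes
  a single sum over the whole domain.\<close>

definition weight :: "int \<Rightarrow> rat" where
  "weight t = (if t < 0 then (-1) ^ nat (-t) / fact (nat (-t + 1)) else (-1) ^ nat (t + 1) * fact (nat t))"

lemma g_eq_sum_weight:
  assumes "finite (dom w)" "0 \<notin> dom w"
  shows "g w = (\<Sum>t\<in>dom w. of_nat (val w t) * weight t)"
proof -
  have "dom w = dom_neg w \<union> dom_pos w"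
    using assms(2) unfolding dom_neg_def dom_pos_def
    by (auto simp del: domIff)
  moreover have "finite (dom_neg w)" "finite (dom_pos w)" "dom_neg w \<inter> dom_pos w = {}"
    using assms(1) by (auto simp: dom_neg_def dom_pos_def)
  moreover have "(\<Sum>t\<in>dom_neg w. of_nat (val w t) * ((-1) ^ nat (-t) / fact (nat (-t + 1))))
      = (\<Sum>t\<in>dom_neg w. of_nat (val w t) * weight t)"
    by (rule sum.cong) (auto simp: weight_def dom_neg_def)
  moreover have "(\<Sum>t\<in>dom_pos w. of_nat (val w t) * (-1) ^ nat (t + 1) * fact (nat t))
      = (\<Sum>t\<in>dom_pos w. of_nat (val w t) * weight t)"
    by (rule sum.cong) (auto simp: weight_def dom_pos_def)
  ultimately show ?thesis
    unfolding g_def by (simp add: sum.union_disjoint)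
qed

text \<open>The factor \<open>c\<close> is \<open>n!\<close> for \<open>t0 = -n\<close> and
  \<open>1 / (n+1)!\<close> for \<open>t0 = n\<close>. Factorial divisibility makes all higher place
  values integers, while the one at \<open>t0\<close> becomes a fraction whose denominator exceeds
  every digit allowed there.\<close>

lemma weight_scaling:
  fixes t0 :: int
  assumes "t0 \<noteq> 0"
  obtains c where "\<And>t. t0 < t \<Longrightarrow> t \<noteq> 0 \<Longrightarrow> c * weight t \<in> \<int>"
    and "\<bar>c * weight t0\<bar> = 1 / (of_int \<bar>t0\<bar> + 1)"
proof (cases "t0 < 0")
  case True
  define n where "n = nat (- t0)"
  have n: "t0 = - int n" "n > 0" using True by (auto simp: n_def)
  show ?thesis
  proof (rule that)
    fix t assume t: "t0 < t" "t \<noteq> 0"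
    show "fact n * weight t \<in> \<int>"
    proof (cases "t < 0")
      case True
      have "(fact (nat (-t + 1)) :: int) dvd fact n"
        using t True n by (intro fact_dvd) auto
      then obtain k where "(fact n :: int) = fact (nat (-t + 1)) * k" by (auto simp: dvd_def)
      then have "of_int (fact n) = (of_int (fact (nat (-t + 1)) * k) :: rat)" by metis
      then have "(fact n :: rat) = fact (nat (-t + 1)) * of_int k" by simp
      then show ?thesis using True by (simp add: weight_def)
    next
      case False
      then show ?thesis by (simp add: weight_def fact_in_Ints)
    qed
  next
    have "nat (- t0 + 1) = Suc n" using n by auto
    then show "\<bar>fact n * weight t0\<bar> = 1 / (of_int \<bar>t0\<bar> + 1)"
      using True n by (simp add: weight_def abs_mult power_abs add.commute)
  qed
next
  case False
  define n where "n = nat t0"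
  have n: "t0 = int n" "n > 0" using False assms by (auto simp: n_def)
  show ?thesis
  proof (rule that)
    fix t assume t: "t0 < t" "t \<noteq> 0"
    have "(fact (Suc n) :: int) dvd fact (nat t)"
      using t n by (intro fact_dvd) auto
    then obtain k where "(fact (nat t) :: int) = fact (Suc n) * k" by (auto simp: dvd_def)
    then have "of_int (fact (nat t)) = (of_int (fact (Suc n) * k) :: rat)" by metis
    then have k: "(fact (nat t) :: rat) = fact (Suc n) * of_int k" by (metis of_int_fact of_int_mult)
    show "1 / fact (Suc n) * weight t \<in> \<int>"
      using t n by (simp add: weight_def k del: fact_Suc)
  next
    show "\<bar>1 / fact (Suc n) * weight t0\<bar> = 1 / (of_int \<bar>t0\<bar> + 1)"
      using False n by (simp add: weight_def abs_mult power_abs add.commute)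
  qed
qed

text \<open>After scaling, the terms above the lowest nonzero digit are integers, while that digit
  contributes a proper fraction.\<close>

lemma weighted_sum_eq_0:
  fixes e :: "int \<Rightarrow> int"
  assumes "finite D" "0 \<notin> D" "\<And>t. t \<in> D \<Longrightarrow> \<bar>e t\<bar> \<le> \<bar>t\<bar>"
    and sum0: "(\<Sum>t\<in>D. of_int (e t) * weight t) = 0"
    and "t \<in> D"
  shows "e t = 0"
proof (rule ccontr)
  assume "e t \<noteq> 0"
  define B where "B = {t \<in> D. e t \<noteq> 0}"
  define t0 where "t0 = Min B"
  have B: "finite B" "B \<noteq> {}" using assms \<open>e t \<noteq> 0\<close> by (auto simp: B_def)
  then have t0: "t0 \<in> B" unfolding t0_def by (rule Min_in)
  have less: "t0 < s" if "s \<in> B - {t0}" for s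
    using that B unfolding t0_def by (simp add: order_less_le)
  have "t0 \<noteq> 0" using t0 assms(2) by (auto simp: B_def)
  then obtain c where c: "\<And>t. t0 < t \<Longrightarrow> t \<noteq> 0 \<Longrightarrow> c * weight t \<in> \<int>"
    and c0: "\<bar>c * weight t0\<bar> = 1 / (of_int \<bar>t0\<bar> + 1)" using weight_scaling by blast
  have "0 = (\<Sum>t\<in>B. of_int (e t) * weight t)"
    unfolding sum0[symmetric] using assms(1)
    by (intro sum.mono_neutral_right) (auto simp: B_def)
  also have "\<dots> = of_int (e t0) * weight t0 + (\<Sum>t\<in>B - {t0}. of_int (e t) * weight t)"
    using B t0 by (simp add: sum.remove)
  finally have "of_int (e t0) * (c * weight t0) + (\<Sum>t\<in>B - {t0}. of_int (e t) * (c * weight t)) = 0"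
    by (simp add: sum_distrib_left mult.left_commute flip: distrib_left sum_distrib_left)
  moreover have "(\<Sum>t\<in>B - {t0}. of_int (e t) * (c * weight t)) \<in> \<int>"
  proof (intro Ints_sum)
    fix s assume s: "s \<in> B - {t0}"
    then have "s \<noteq> 0" using assms(2) by (auto simp: B_def)
    then show "of_int (e s) * (c * weight s) \<in> \<int>"
      using c[OF less[OF s]] by simp
  qed
  ultimately have "of_int (e t0) * (c * weight t0) \<in> \<int>"
    by (metis Ints_minus add.inverse_inverse add_eq_0_iff)
  then obtain z where z: "of_int (e t0) * (c * weight t0) = of_int z" by (auto elim: Ints_cases)
  \<comment> \<open>The bound \<open>\<bar>t0\<bar>\<close> on the digit is less than the
    denominator \<open>\<bar>t0\<bar> + 1\<close>, so the integer \<open>z\<close> has absolute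
    value less than 1 and vanishes.\<close>
  have "\<bar>of_int z\<bar> = \<bar>of_int (e t0)\<bar> / (of_int \<bar>t0\<bar> + 1 :: rat)"
    unfolding z[symmetric] abs_mult[of _ "c * weight t0"] c0 by simp
  moreover have "\<bar>of_int (e t0) :: rat\<bar> < of_int \<bar>t0\<bar> + 1"
    using assms(3)[of t0] t0 unfolding B_def
    by (metis (mono_tags, lifting) less_add_one mem_Collect_eq of_int_1 of_int_abs of_int_add of_int_less_iff order_le_less_trans)
  ultimately have "\<bar>of_int z :: rat\<bar> < 1" by simp
  then have "z = 0" by linarith
  then have "of_int (e t0) * (c * weight t0) = 0" using z by simp
  moreover have "c * weight t0 \<noteq> 0" using c0 by (metis abs_0 abs_ge_zero add_strict_increasing2 divide_eq_0_iff less_irrefl of_int_abs zero_less_one zero_neq_one)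
  ultimately show False using t0 by (simp add: B_def)
qed

section \<open>Uniqueness of digit expansions\<close>

lemma LtildeD:
  assumes "v \<in> Ltilde"
  shows "finite (dom v)" "dom v \<noteq> {}" "0 \<notin> dom v"
    and "\<And>t. t \<in> dom v \<Longrightarrow> v t = Some (Num (val v t)) \<and> 1 \<le> val v t \<and> int (val v t) \<le> \<bar>t\<bar>"
proof -
  show "finite (dom v)" "dom v \<noteq> {}" "0 \<notin> dom v"
    using assms by (simp_all add: Ltilde_def)
  fix t assume "t \<in> dom v"
  then obtain k where "v t = Some (Num k)" "1 \<le> k" "int k \<le> \<bar>t\<bar>"
    using assms unfolding Ltilde_def by blast
  then show "v t = Some (Num (val v t)) \<and> 1 \<le> val v t \<and> int (val v t) \<le> \<bar>t\<bar>"
    by (simp add: val_def)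
qed

lemma val_eq_0: "t \<notin> dom w \<Longrightarrow> val w t = 0"
  by (auto simp: val_def domIff)

lemma g_eq_sum_superset:
  assumes "v \<in> Ltilde" "finite D" "dom v \<subseteq> D"
  shows "g v = (\<Sum>t\<in>D. of_nat (val v t) * weight t)"
  unfolding g_eq_sum_weight[OF LtildeD(1,3)[OF assms(1)]]
  using assms by (intro sum.mono_neutral_left) (auto simp: val_eq_0)

text \<open>Two digits at position \<open>t\<close> lie between 0 and \<open>\<bar>t\<bar>\<close>,
  so their difference satisfies the bound of \<open>weighted_sum_eq_0\<close> on the union of the
  two domains.\<close>

lemma inj_on_g: "inj_on g Ltilde"
proof (rule inj_onI)
  fix v v' assume v: "v \<in> Ltilde" "v' \<in> Ltilde" and "g v = g v'"
  define D where "D = dom v \<union> dom v'"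
  have D: "finite D" "0 \<notin> D" using LtildeD[OF v(1)] LtildeD[OF v(2)] by (auto simp: D_def)
  have bound: "int (val u t) \<le> \<bar>t\<bar>" if "u \<in> Ltilde" for u t
    using LtildeD(4)[OF that, of t] val_eq_0[of t u] by (cases "t \<in> dom u") auto
  have "(\<Sum>t\<in>D. of_int (int (val v t) - int (val v' t)) * weight t) = g v - g v'"
    using v D by (simp add: g_eq_sum_superset[of _ D] D_def algebra_simps flip: sum_subtractf)
  then have eq: "val v t = val v' t" if "t \<in> D" for t
    using weighted_sum_eq_0[of D "\<lambda>t. int (val v t) - int (val v' t)" t] D that
      bound[OF v(1), of t] bound[OF v(2), of t] \<open>g v = g v'\<close>
    by (smt (verit) bound v cancel_comm_monoid_add_class.diff_cancel of_nat_0_le_iff of_nat_eq_iff)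
  show "v = v'"
  proof
    fix t show "v t = v' t"
      \<comment> \<open>Digits of words are at least 1 and \<open>val\<close> is 0 off the domain,
        so \<open>val\<close> also determines the domain.\<close>
      using eq[of t] LtildeD(4)[OF v(1), of t] LtildeD(4)[OF v(2), of t] val_eq_0[of t v] val_eq_0[of t v']
      unfolding D_def by (metis UnCI domIff not_one_le_zero)
  qed
qed

text \<open>This makes the hypotheses on \<open>T q\<close>, which concern only nonzero
  \<open>q\<close>, available for \<open>q = g v\<close>.\<close>

lemma g_neq_0:
  assumes "v \<in> Ltilde" shows "g v \<noteq> 0"
proof
  assume "g v = 0"
  obtain t where t: "t \<in> dom v" using LtildeD(2)[OF assms] by auto
  have "int (val v t) = 0"
    using \<open>g v = 0\<close> LtildeD[OF assms] t
    by (intro weighted_sum_eq_0[of "dom v" "\<lambda>t. int (val v t)"]) (auto simp: g_eq_sum_weight simp del: domIff)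
  then show False using LtildeD(4)[OF assms t] by simp
qed

lemma g_inv_g: "v \<in> Ltilde \<Longrightarrow> g_inv (g v) = v"
  unfolding g_inv_def by (rule inv_into_f_f[OF inj_on_g])

section \<open>Nested words\<close>

text \<open>The relation \<open>R1_less\<close> on domains, freed of \<open>Max\<close> and
  \<open>Min\<close>, so that transitivity and unions become pure quantifier reasoning.\<close>

definition encl :: "'a::linorder set \<Rightarrow> 'a set \<Rightarrow> bool" where
  "encl D E \<longleftrightarrow> (\<exists>t\<in>E. \<forall>s\<in>D. t < s) \<and> (\<exists>t\<in>E. \<forall>s\<in>D. s < t) \<and>
     (\<forall>t\<in>E. (\<forall>s\<in>D. t < s) \<or> (\<forall>s\<in>D. s < t))"

lemma encl_hull:
  assumes "encl D E" "s \<in> D"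
  shows "\<exists>a\<in>E. \<exists>b\<in>E. a \<le> s \<and> s \<le> b"
proof -
  obtain a b where "a \<in> E" "\<forall>s\<in>D. a < s" "b \<in> E" "\<forall>s\<in>D. s < b"
    using assms(1) unfolding encl_def by blast
  then show ?thesis using assms(2) by (meson less_imp_le)
qed

text \<open>Whether \<open>D\<close> is enclosed depends only on the interval that it spans. This
  yields transitivity and lets the outermost word stand for a whole concatenation.\<close>

lemma encl_mono:
  assumes "encl D E" and hull: "\<And>s. s \<in> C \<Longrightarrow> \<exists>a\<in>D. \<exists>b\<in>D. a \<le> s \<and> s \<le> b"
  shows "encl C E"
proof -
  have "\<forall>s\<in>C. t < s" if "\<forall>s\<in>D. t < s" for t
    using hull that by (meson less_le_trans)
  moreover have "\<forall>s\<in>C. s < t" if "\<forall>s\<in>D. s < t" for t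
    using hull that by (meson le_less_trans)
  ultimately show ?thesis using assms(1) unfolding encl_def by blast
qed

lemma encl_trans: "encl C D \<Longrightarrow> encl D E \<Longrightarrow> encl C E"
  by (rule encl_mono) (auto dest: encl_hull)

lemma encl_disjoint: "encl D E \<Longrightarrow> D \<inter> E = {}"
  unfolding encl_def by blast

lemma R1_less_iff_encl:
  assumes "finite (dom w)" "dom w \<noteq> {}" "finite (dom u)"
  shows "R1_less w u \<longleftrightarrow> encl (dom w) (dom u)"
proof
  assume "R1_less w u"
  then obtain A1 A2 where A: "dom u = A1 \<union> A2" "A1 \<noteq> {}" "A2 \<noteq> {}"
    "Max A1 < Min (dom w)" "Max (dom w) < Min A2" unfolding R1_less_def by blast
  have fin: "finite A1" "finite A2" using A(1) assms(3) by (metis finite_Un)+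
  have "t < s" if "t \<in> A1" "s \<in> dom w" for t s
    using A(4) Max_ge[OF fin(1) that(1)] Min_le[OF assms(1) that(2)] by linarith
  moreover have "s < t" if "t \<in> A2" "s \<in> dom w" for t s
    using A(5) Min_le[OF fin(2) that(1)] Max_ge[OF assms(1) that(2)] by linarith
  ultimately show "encl (dom w) (dom u)"
    using A(1-3) unfolding encl_def by blast
next
  assume E: "encl (dom w) (dom u)"
  \<comment> \<open>The splitting required by \<open>R1_less\<close> is recovered as the part of
    \<open>dom u\<close> below \<open>dom w\<close> and the part above it.\<close>
  define A1 where "A1 = {t \<in> dom u. \<forall>s\<in>dom w. t < s}"
  define A2 where "A2 = {t \<in> dom u. \<forall>s\<in>dom w. s < t}"
  have A: "dom u = A1 \<union> A2" "A1 \<noteq> {}" "A2 \<noteq> {}"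
    using E by (auto simp: encl_def A1_def A2_def simp del: domIff)
  have fin: "finite A1" "finite A2" using assms(3) by (auto simp: A1_def A2_def)
  have "Max A1 \<in> A1" "Min A2 \<in> A2" "Min (dom w) \<in> dom w" "Max (dom w) \<in> dom w"
    using fin A assms by (auto simp del: domIff)
  then have "Max A1 < Min (dom w)" "Max (dom w) < Min A2" "Min (dom w) \<le> Max (dom w)"
    using assms(1) by (auto simp: A1_def A2_def simp del: domIff)
  then show "R1_less w u" unfolding R1_less_def using A by blast
qed

section \<open>Concatenation over finite sets of indices\<close>

definition join :: "(nat \<Rightarrow> lword) \<Rightarrow> nat set \<Rightarrow> lword" where
  "join v S = star_list (map v (sorted_list_of_set S))"

lemma star_list_append: "star_list (xs @ ys) = star_list xs ++ star_list ys"
  by (induction xs) (auto simp: star_list_def)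

lemma join_empty [simp]: "join v {} = Map.empty"
  by (simp add: join_def star_list_def)

text \<open>The recursion behind all inductions on index sets: the new index is the largest one, so
  its word is the outermost one.\<close>

lemma join_insert:
  assumes "finite S" "\<And>k. k \<in> S \<Longrightarrow> k < n"
  shows "join v (insert n S) = join v S ++ v n"
proof -
  have "n \<notin> S" using assms(2) by blast
  then have "sorted_list_of_set (insert n S) = sorted_list_of_set S @ [n]"
    using assms by (auto simp: sorted_list_of_set_insert_remove order_less_imp_le intro!: sorted_insort_is_snoc)
  then show ?thesis
    by (simp add: join_def star_list_append) (simp add: star_list_def)
qed

lemma join_singleton [simp]: "join v {n} = v n"
  by (simp add: join_def star_list_def)

lemma dom_join: "finite S \<Longrightarrow> dom (join v S) = (\<Union>n\<in>S. dom (v n))"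
  by (induction S rule: finite_linorder_max_induct) (auto simp: join_insert)

lemma subst_map_add: "subst (w ++ u) a b = subst w a b ++ subst u a b"
  by (rule ext) (auto simp: subst_def map_add_def split: option.splits)

lemma subst_join: "finite S \<Longrightarrow> subst (join v S) a b = join (\<lambda>n. subst (v n) a b) S"
  by (induction S rule: finite_linorder_max_induct)
    (auto simp: join_insert subst_map_add, simp add: subst_def)

lemma subst_Var_Var [simp]: "subst w Var Var = w"
  by (rule ext) (auto simp: subst_def)

lemma dom_subst [simp]: "dom (subst w a b) = dom w"
  by (auto simp: subst_def dom_def split: if_splits)

lemma map_add_in_Ltilde:
  assumes "v \<in> Ltilde" "v' \<in> Ltilde"
  shows "v ++ v' \<in> Ltilde"
proof -
  have "\<exists>k. (v ++ v') t = Some (Num k) \<and> 1 \<le> k \<and> int k \<le> \<bar>t\<bar>" if "t \<in> dom (v ++ v')" for t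
    using LtildeD(4)[OF assms(1), of t] LtildeD(4)[OF assms(2), of t] that
    by (cases "t \<in> dom v'") (auto simp: map_add_dom_app_simps)
  then show ?thesis
    using LtildeD(1-3)[OF assms(1)] LtildeD(1-3)[OF assms(2)] unfolding Ltilde_def
    by (auto simp: Un_commute simp del: domIff)
qed

lemma g_map_add:
  assumes "v \<in> Ltilde" "v' \<in> Ltilde" "dom v \<inter> dom v' = {}"
  shows "g (v ++ v') = g v + g v'"
proof -
  note v = map_add_in_Ltilde[OF assms(1,2)]
  have "g (v ++ v') = (\<Sum>t\<in>dom v. of_nat (val (v ++ v') t) * weight t)
      + (\<Sum>t\<in>dom v'. of_nat (val (v ++ v') t) * weight t)"
    using LtildeD(1)[OF assms(1)] LtildeD(1)[OF assms(2)] assms(3)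
    by (simp add: g_eq_sum_weight[OF LtildeD(1,3)[OF v]] sum.union_disjoint Un_commute)
  also have "(\<Sum>t\<in>dom v. of_nat (val (v ++ v') t) * weight t) = g v"
    unfolding g_eq_sum_weight[OF LtildeD(1,3)[OF assms(1)]] using assms(3)
    by (intro sum.cong refl) (auto simp: val_def map_add_dom_app_simps(3) disjoint_iff simp del: domIff)
  also have "(\<Sum>t\<in>dom v'. of_nat (val (v ++ v') t) * weight t) = g v'"
    unfolding g_eq_sum_weight[OF LtildeD(1,3)[OF assms(2)]]
    by (intro sum.cong refl) (auto simp: val_def map_add_dom_app_simps(1) simp del: domIff)
  finally show ?thesis .
qed

text \<open>Enclosure is required for all pairs and not only for neighbouring indices, so the
  property passes to subsets.\<close>

definition nested :: "(nat \<Rightarrow> lword) \<Rightarrow> nat set \<Rightarrow> bool" where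
  "nested v S \<longleftrightarrow> (\<forall>n\<in>S. \<forall>k\<in>S. n < k \<longrightarrow> encl (dom (v n)) (dom (v k)))"

text \<open>The word of the largest index in \<open>S\<close> encloses the others, so it spans the
  same interval as the whole concatenation.\<close>

lemma encl_dom_join:
  assumes "nested v (insert n S)" "finite S" "S \<noteq> {}" "\<And>k. k \<in> S \<Longrightarrow> k < n"
  shows "encl (dom (join v S)) (dom (v n))"
proof (rule encl_mono)
  show "encl (dom (v (Max S))) (dom (v n))"
    using assms by (simp add: nested_def)
  fix s assume "s \<in> dom (join v S)"
  then obtain k where k: "k \<in> S" "s \<in> dom (v k)"
    unfolding dom_join[OF assms(2)] by blast
  show "\<exists>a\<in>dom (v (Max S)). \<exists>b\<in>dom (v (Max S)). a \<le> s \<and> s \<le> b"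
  proof (cases "k = Max S")
    case True
    then show ?thesis using k by auto
  next
    case False
    then have "k < Max S" using k assms(2) by (simp add: order_less_le)
    then have "encl (dom (v k)) (dom (v (Max S)))"
      using assms k by (simp add: nested_def)
    then show ?thesis using encl_hull k(2) by blast
  qed
qed

lemma join_in_Ltilde:
  assumes "finite S" "S \<noteq> {}" "\<And>n. n \<in> S \<Longrightarrow> v n \<in> Ltilde"
  shows "join v S \<in> Ltilde"
  using assms
proof (induction S rule: finite_linorder_max_induct)
  case (insert n S)
  then show ?case
    by (cases "S = {}") (auto simp: join_insert map_add_in_Ltilde)
qed simp

text \<open>Nested words have disjoint domains, and on disjoint domains \<open>g\<close> is
  additive.\<close>

lemma g_join:
  assumes "finite S" "\<And>n. n \<in> S \<Longrightarrow> v n \<in> Ltilde" "nested v S"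
  shows "g (join v S) = (\<Sum>n\<in>S. g (v n))"
  using assms
proof (induction S rule: finite_linorder_max_induct)
  case empty
  then show ?case by (simp add: g_def dom_neg_def dom_pos_def)
next
  case (insert n S)
  have IH: "g (join v S) = (\<Sum>n\<in>S. g (v n))"
    using insert by (simp add: nested_def)
  show ?case
  proof (cases "S = {}")
    case True
    then show ?thesis by (simp add: join_insert)
  next
    case False
    have "dom (join v S) \<inter> dom (v n) = {}"
      using insert False by (intro encl_disjoint encl_dom_join) auto
    then have "g (join v (insert n S)) = g (join v S) + g (v n)"
      using insert False by (simp add: join_insert g_map_add join_in_Ltilde)
    then show ?thesis using insert IH by (auto simp: add.commute)
  qed
qed

section \<open>Multiple recurrence for commuting homeomorphisms\<close>

text \<open>The group is kept apart from the space on which it acts, so that the same group can act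
  on a closed invariant subset in place of \<open>X\<close>.\<close>

locale comm_action = comm_group A for A (structure) +
  fixes X :: "'x::metric_space set" and act :: "'b \<Rightarrow> 'x \<Rightarrow> 'x"
  assumes compact_X: "compact X"
    and act_in: "h \<in> carrier A \<Longrightarrow> x \<in> X \<Longrightarrow> act h x \<in> X"
    and act_cont: "h \<in> carrier A \<Longrightarrow> continuous_on X (act h)"
    and act_mult: "h \<in> carrier A \<Longrightarrow> k \<in> carrier A \<Longrightarrow> x \<in> X \<Longrightarrow> act (h \<otimes> k) x = act h (act k x)"
    and act_one: "x \<in> X \<Longrightarrow> act \<one> x = x"
begin

definition minimal :: bool where
  "minimal \<longleftrightarrow> (\<forall>C. closedin (top_of_set X) C \<and> C \<noteq> {} \<and> (\<forall>h\<in>carrier A. act h ` C \<subseteq> C) \<longrightarrow> C = X)"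

lemma act_commute:
  assumes "h \<in> carrier A" "k \<in> carrier A" "x \<in> X"
  shows "act h (act k x) = act k (act h x)"
  using assms by (metis act_mult m_comm)

lemma act_act_inv: "h \<in> carrier A \<Longrightarrow> x \<in> X \<Longrightarrow> act h (act (inv h) x) = x"
  by (metis act_mult act_one inv_closed r_inv)

lemma openin_act_preimage:
  assumes "h \<in> carrier A" "openin (top_of_set X) V"
  shows "openin (top_of_set X) (X \<inter> act h -` V)"
  using assms act_in by (intro continuous_openin_preimage[of X "act h" X V] act_cont) auto

text \<open>The points whose orbit avoids \<open>V\<close> form a closed invariant set, which misses
  \<open>V\<close> and is therefore empty by minimality. So the preimages of \<open>V\<close> cover
  \<open>X\<close>, and compactness leaves finitely many.\<close>

lemma minimal_finite_cover:
  assumes minimal "openin (top_of_set X) V" "V \<noteq> {}"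
  obtains H where "finite H" "H \<subseteq> carrier A" "X \<subseteq> (\<Union>h\<in>H. X \<inter> act h -` V)"
proof -
  define \<U> where "\<U> = (\<lambda>h. X \<inter> act h -` V) ` carrier A"
  have op: "openin (top_of_set X) U" if "U \<in> \<U>" for U
    using that openin_act_preimage assms(2) by (auto simp: \<U>_def)
  have "V \<subseteq> X" using assms(2) openin_imp_subset by blast
  have "X - \<Union>\<U> = {}"
  proof (rule ccontr)
    assume ne: "X - \<Union>\<U> \<noteq> {}"
    have "openin (top_of_set X) (\<Union>\<U>)" using op by blast
    then have "closedin (top_of_set X) (X - \<Union>\<U>)" by (auto intro: closedin_diff)
    moreover have "act h ` (X - \<Union>\<U>) \<subseteq> X - \<Union>\<U>" if h: "h \<in> carrier A" for h
    proof clarify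
      fix x assume x: "x \<in> X" "x \<notin> \<Union>\<U>"
      have "act k (act h x) \<notin> V" if "k \<in> carrier A" for k
      proof -
        have "act (k \<otimes> h) x \<notin> V" using x m_closed[OF that h] by (auto simp: \<U>_def)
        then show ?thesis by (simp add: act_mult[OF that h x(1)])
      qed
      then show "act h x \<in> X - \<Union>\<U>" using act_in h x by (auto simp: \<U>_def)
    qed
    ultimately have "X - \<Union>\<U> = X"
      using assms(1)[unfolded minimal_def, rule_format, of "X - \<Union>\<U>"] ne by simp
    moreover obtain x where "x \<in> V" using assms(3) by blast
    moreover have "x \<in> \<Union>\<U>"
      using \<open>x \<in> V\<close> \<open>V \<subseteq> X\<close> act_one[of x] one_closed unfolding \<U>_def
      by (intro UnionI[of "X \<inter> act \<one> -` V"]) auto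
    ultimately show False using \<open>V \<subseteq> X\<close> by blast
  qed
  then have "X \<subseteq> \<Union>\<U>" by blast
  then obtain D where D: "D \<subseteq> \<U>" "finite D" "X \<subseteq> \<Union>D"
    using op compact_X unfolding compact_eq_openin_cover by metis
  then obtain H where "H \<subseteq> carrier A" "finite H" "D = (\<lambda>h. X \<inter> act h -` V) ` H"
    unfolding \<U>_def by (meson finite_subset_image)
  then show ?thesis using D that by blast
qed

text \<open>One step of the Furstenberg--Weiss argument: recurrence for the quotients \<open>f i n \<otimes> inv f l n\<close>
  gives returns to \<open>U\<close> from an open set that a translate from the finite set \<open>H\<close> moves into \<open>V\<close>.\<close>

lemma recurrence_step:
  fixes f :: "'i \<Rightarrow> nat \<Rightarrow> 'b"
  assumes IH: "\<And>(f :: 'i \<Rightarrow> nat \<Rightarrow> 'b) (N :: nat) U. (\<And>i n. i \<in> I \<Longrightarrow> n \<ge> N \<Longrightarrow> f i n \<in> carrier A) \<Longrightarrow>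
      openin (top_of_set X) U \<Longrightarrow> U \<noteq> {} \<Longrightarrow>
      \<exists>S y. finite S \<and> S \<noteq> {} \<and> S \<subseteq> {N..} \<and> y \<in> U \<and> (\<forall>i\<in>I. act (finprod A (f i) S) y \<in> U)"
    and "finite I"
    and f: "\<And>i n. i \<in> insert l I \<Longrightarrow> n \<ge> N \<Longrightarrow> f i n \<in> carrier A"
    and H: "H \<subseteq> carrier A" "X \<subseteq> (\<Union>h\<in>H. X \<inter> act h -` V)"
    and V: "openin (top_of_set X) V"
    and U: "openin (top_of_set X) U" "U \<noteq> {}"
  shows "\<exists>S h W. finite S \<and> S \<noteq> {} \<and> S \<subseteq> {N..} \<and> h \<in> H \<and> openin (top_of_set X) W \<and> W \<noteq> {} \<and>
    W \<subseteq> X \<inter> act h -` V \<and> (\<forall>i\<in>insert l I. \<forall>x\<in>W. act (finprod A (f i) S) x \<in> U)"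
proof -
  have "U \<subseteq> X" using U(1) openin_imp_subset by blast
  define f' where "f' = (\<lambda>i n. f i n \<otimes> inv (f l n))"
  have f': "f' i n \<in> carrier A" if "i \<in> I" "n \<ge> N" for i n
    using f that by (simp add: f'_def)
  have "\<exists>S y. finite S \<and> S \<noteq> {} \<and> S \<subseteq> {N..} \<and> y \<in> U \<and> (\<forall>i\<in>I. act (finprod A (f' i) S) y \<in> U)"
    using IH[of N f' U] f' U by blast
  then obtain S y where S: "finite S" "S \<noteq> {}" "S \<subseteq> {N..}" "y \<in> U"
    and y: "\<forall>i\<in>I. act (finprod A (f' i) S) y \<in> U" by (elim exE conjE) (rule that)
  define p where "p = finprod A (f l) S"
  have fS: "f i \<in> S \<rightarrow> carrier A" if "i \<in> insert l I" for i using f S(3) that by auto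
  have pc: "finprod A (f i) S \<in> carrier A" if "i \<in> insert l I" for i using fS[OF that] by simp
  then have p: "p \<in> carrier A" by (simp add: p_def)
  \<comment> \<open>Pulling \<open>y\<close> back by the product \<open>p\<close> of the family
    \<open>l\<close> makes that family return \<open>z\<close> to \<open>y\<close>. Every other
    family then acts on \<open>z\<close> as its quotient family acts on \<open>y\<close>.\<close>
  define z where "z = act (inv p) y"
  have z: "z \<in> X" "act p z = y"
    using p \<open>y \<in> U\<close> \<open>U \<subseteq> X\<close> by (auto simp: z_def act_act_inv act_in)
  obtain h where h: "h \<in> H" "act h z \<in> V" using H(2) z(1) by blast
  \<comment> \<open>All that holds at \<open>z\<close> is an open condition, so it persists on a
    whole open set.\<close>
  define W where "W = (X \<inter> act h -` V) \<inter> ((\<Inter>i\<in>insert l I. X \<inter> act (finprod A (f i) S) -` U) \<inter> X)"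
  have "act (finprod A (f i) S) z \<in> U" if "i \<in> insert l I" for i
  proof (cases "i = l")
    case True
    then show ?thesis using z \<open>y \<in> U\<close> by (simp add: p_def)
  next
    case False
    then have i: "i \<in> I" using that by simp
    have f'S: "f' i \<in> S \<rightarrow> carrier A" using f i S(3) by (auto simp: f'_def)
    have "finprod A (f i) S = finprod A (\<lambda>n. f' i n \<otimes> f l n) S"
    proof (rule finprod_cong')
      fix n assume "n \<in> S"
      then have "f i n \<in> carrier A" "f l n \<in> carrier A" using f i S(3) by auto
      then show "f i n = f' i n \<otimes> f l n" by (simp add: f'_def m_assoc)
    qed (use f'S fS[of l] in auto)
    also have "\<dots> = finprod A (f' i) S \<otimes> p"
      unfolding p_def using f'S fS[of l] by (intro finprod_multf) auto
    finally show ?thesis using y i z p f'S by (simp add: act_mult)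
  qed
  then have "z \<in> W" using z(1) h(2) by (auto simp: W_def)
  moreover have "openin (top_of_set X) W"
  proof -
    have "openin (top_of_set X) ((\<Inter>i\<in>insert l I. X \<inter> act (finprod A (f i) S) -` U) \<inter> topspace (top_of_set X))"
      using \<open>finite I\<close> pc U(1) by (intro openin_INT openin_act_preimage) auto
    moreover have "openin (top_of_set X) (X \<inter> act h -` V)"
      using openin_act_preimage h(1) H(1) V by blast
    ultimately show ?thesis unfolding W_def by (auto intro!: openin_Int simp del: INT_simps)
  qed
  moreover have "W \<subseteq> X \<inter> act h -` V" "\<forall>i\<in>insert l I. \<forall>x\<in>W. act (finprod A (f i) S) x \<in> U"
    by (auto simp: W_def)
  ultimately show ?thesis using S h(1) by blast
qed

text \<open>Induction on the number of families. A sequence of open sets is built, each carried into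
  its predecessor by products over a new block and into \<open>V\<close> by a translate from a
  finite set. Two of them share the same translate, and that translate turns the passage between
  them into a return to \<open>V\<close>.\<close>

lemma multiple_recurrence:
  fixes f :: "'i \<Rightarrow> nat \<Rightarrow> 'b"
  assumes minimal "finite I"
    and "\<And>i n. i \<in> I \<Longrightarrow> n \<ge> N \<Longrightarrow> f i n \<in> carrier A"
    and "openin (top_of_set X) V" "V \<noteq> {}"
  shows "\<exists>S y. finite S \<and> S \<noteq> {} \<and> S \<subseteq> {N..} \<and> y \<in> V \<and> (\<forall>i\<in>I. act (finprod A (f i) S) y \<in> V)"
  using assms(2-)
proof (induction I arbitrary: f N V rule: finite_induct)
  case empty
  then obtain y where "y \<in> V" by blast
  then show ?case by (intro exI[of _ "{N}"] exI[of _ y]) auto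
next
  case (insert l I)
  note f = insert.prems(1) and V = insert.prems(2,3)
  obtain H where H: "finite H" "H \<subseteq> carrier A" "X \<subseteq> (\<Union>h\<in>H. X \<inter> act h -` V)"
    using minimal_finite_cover[OF assms(1) V] .
  have VX: "V \<subseteq> X" using V(1) openin_imp_subset by blast
  \<comment> \<open>The identity is added because the sequence starts with \<open>V\<close>
    itself.\<close>
  let ?H = "insert \<one> H"
  define P where "P = (\<lambda>(U, h, M::nat). openin (top_of_set X) U \<and> U \<noteq> {} \<and> h \<in> ?H \<and>
      U \<subseteq> X \<inter> act h -` V \<and> N \<le> M)"
  \<comment> \<open>Half-open blocks \<open>{M..<M'}\<close> keep successive index sets disjoint, so
    that composing the moves gives the product over their union.\<close>
  define Q where "Q = (\<lambda>(U, h::'b, M) (U', h'::'b, M'). \<exists>S. finite S \<and> S \<noteq> {} \<and> S \<subseteq> {M..<M'} \<and> M \<le> M' \<and>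
      (\<forall>i\<in>insert l I. \<forall>x\<in>U'. act (finprod A (f i) S) x \<in> U))"
  have "\<exists>s. \<forall>k. P (s k) \<and> Q (s k) (s (Suc k))"
  proof (rule dependent_nat_choice)
    show "\<exists>s. P s"
      using V VX by (intro exI[of _ "(V, \<one>, N)"]) (auto simp: P_def act_one)
  next
    fix s :: "'x set \<times> 'b \<times> nat" and k :: nat assume "P s"
    moreover obtain U h M where s: "s = (U, h, M)" using prod_cases3 by blast
    ultimately have U: "openin (top_of_set X) U" "U \<noteq> {}" and "N \<le> M" by (auto simp: P_def)
    have "\<exists>S h W. finite S \<and> S \<noteq> {} \<and> S \<subseteq> {M..} \<and> h \<in> H \<and> openin (top_of_set X) W \<and> W \<noteq> {} \<and>
      W \<subseteq> X \<inter> act h -` V \<and> (\<forall>i\<in>insert l I. \<forall>x\<in>W. act (finprod A (f i) S) x \<in> U)"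
      using insert.IH insert.hyps(1) f \<open>N \<le> M\<close> H(2,3) V(1) U
      by (intro recurrence_step) auto
    then obtain S h' W where S: "finite S" "S \<noteq> {}" "S \<subseteq> {M..}" "h' \<in> H"
      "openin (top_of_set X) W" "W \<noteq> {}" "W \<subseteq> X \<inter> act h' -` V"
      "\<forall>i\<in>insert l I. \<forall>x\<in>W. act (finprod A (f i) S) x \<in> U" by blast
    define M' where "M' = Suc (Max S)"
    have "Max S \<in> S" using S(1,2) by simp
    then have "M \<le> M'" using S(3) by (auto simp: M'_def)
    moreover have "S \<subseteq> {M..<M'}"
      using S(1,3) Max_ge[of S] by (auto simp: M'_def less_Suc_eq_le)
    ultimately show "\<exists>s'. P s' \<and> Q s s'"
      using S \<open>N \<le> M\<close> by (intro exI[of _ "(W, h', M')"]) (auto simp: P_def Q_def s)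
  qed
  then obtain s where s: "\<And>k. P (s k)" "\<And>k. Q (s k) (s (Suc k))" by blast
  define U h M where "U k = fst (s k)" and "h k = fst (snd (s k))" and "M k = snd (snd (s k))" for k
  have U: "openin (top_of_set X) (U k)" "U k \<noteq> {}" "U k \<subseteq> X \<inter> act (h k) -` V" "h k \<in> ?H" "N \<le> M k" for k
    using s(1)[of k] by (auto simp: P_def U_def h_def M_def split: prod.splits)
  have step: "\<exists>S. finite S \<and> S \<noteq> {} \<and> S \<subseteq> {M k..<M (Suc k)} \<and> M k \<le> M (Suc k) \<and>
      (\<forall>i\<in>insert l I. \<forall>x\<in>U (Suc k). act (finprod A (f i) S) x \<in> U k)" for k
    using s(2)[of k] by (simp add: Q_def U_def h_def M_def split: prod.splits)
  \<comment> \<open>The moves from stage \<open>Suc (a + d)\<close> down to stage \<open>a\<close>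
    are composed into one product, with the same index set for all families.\<close>
  have chain: "\<exists>S. finite S \<and> S \<noteq> {} \<and> S \<subseteq> {M a..<M (Suc (a + d))} \<and>
      (\<forall>i\<in>insert l I. \<forall>x\<in>U (Suc (a + d)). act (finprod A (f i) S) x \<in> U a)" for a d
  proof (induction d)
    case 0
    then show ?case using step[of a] by auto
  next
    case (Suc d)
    then obtain S where S: "finite S" "S \<noteq> {}" "S \<subseteq> {M a..<M (Suc (a + d))}"
      "\<forall>i\<in>insert l I. \<forall>x\<in>U (Suc (a + d)). act (finprod A (f i) S) x \<in> U a" by (elim exE conjE) (rule that)
    obtain S' where S': "finite S'" "S' \<subseteq> {M (Suc (a + d))..<M (Suc (Suc (a + d)))}"
      "M (Suc (a + d)) \<le> M (Suc (Suc (a + d)))"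
      "\<forall>i\<in>insert l I. \<forall>x\<in>U (Suc (Suc (a + d))). act (finprod A (f i) S') x \<in> U (Suc (a + d))"
      using step[of "Suc (a + d)"] by (elim exE conjE) (rule that)
    have "M a \<le> M (Suc (a + d))" using S(2,3) by fastforce
    have disj: "S \<inter> S' = {}" using S(3) S'(2) by fastforce
    have "act (finprod A (f i) (S \<union> S')) x \<in> U a" if i: "i \<in> insert l I" and x: "x \<in> U (Suc (Suc (a + d)))" for i x
    proof -
      have fc: "f i \<in> S \<rightarrow> carrier A" "f i \<in> S' \<rightarrow> carrier A"
        using S(3) S'(2) f[OF i] U(5)[of a] U(5)[of "Suc (a + d)"] by fastforce+
      have "x \<in> X" using U(3) x by blast
      have "finprod A (f i) (S \<union> S') = finprod A (f i) S \<otimes> finprod A (f i) S'"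
        using S(1) S'(1) disj fc by (intro finprod_Un_disjoint)
      then have eq: "act (finprod A (f i) (S \<union> S')) x = act (finprod A (f i) S) (act (finprod A (f i) S') x)"
        using fc \<open>x \<in> X\<close> by (simp add: act_mult)
      have "act (finprod A (f i) S') x \<in> U (Suc (a + d))" using S'(4) i x by blast
      then have "act (finprod A (f i) S) (act (finprod A (f i) S') x) \<in> U a"
        using S(4) i by blast
      then show ?thesis using eq by simp
    qed
    moreover have "S \<union> S' \<subseteq> {M a..<M (Suc (a + Suc d))}"
      using S(3) S'(2,3) \<open>M a \<le> M (Suc (a + d))\<close> by fastforce
    ultimately show ?case using S(1,2) S'(1)
      by (intro exI[of _ "S \<union> S'"]) auto
  qed
  \<comment> \<open>Pigeonhole: the translates come from a finite set.\<close>
  have "\<not> inj h"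
  proof
    assume "inj h"
    then have "infinite (range h)" by (rule range_inj_infinite)
    moreover have "range h \<subseteq> ?H" using U(4) by auto
    ultimately show False using H(1) finite_subset by blast
  qed
  then obtain a b where "a < b" "h a = h b"
    by (metis injI linorder_neqE_nat)
  then obtain d where b: "b = Suc (a + d)" using less_iff_Suc_add by blast
  obtain S where S: "finite S" "S \<noteq> {}" "S \<subseteq> {M a..<M b}"
    "\<forall>i\<in>insert l I. \<forall>x\<in>U b. act (finprod A (f i) S) x \<in> U a" using chain[of a d, folded b]
    by (elim exE conjE) (rule that)
  obtain x where x: "x \<in> U b" using U(2) by blast
  have hb: "h b \<in> carrier A" using U(4)[of b] H(2) by auto
  show ?case
  proof (intro exI conjI ballI)
    show "finite S" "S \<noteq> {}" "S \<subseteq> {N..}" using S U(5)[of a] by auto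
    show "act (h b) x \<in> V" using x U(3) by blast
    fix i assume i: "i \<in> insert l I"
    have "f i \<in> S \<rightarrow> carrier A" using S(3) U(5)[of a] f[OF i] by fastforce
    \<comment> \<open>By commutativity the product may act first. It sends \<open>x\<close> into
      \<open>U a\<close>, and \<open>h b = h a\<close> maps \<open>U a\<close> into
      \<open>V\<close>.\<close>
    then have "act (finprod A (f i) S) (act (h b) x) = act (h b) (act (finprod A (f i) S) x)"
      using hb x U(3) by (intro act_commute) auto
    moreover have "act (finprod A (f i) S) x \<in> U a" using S(4) i x by blast
    ultimately show "act (finprod A (f i) S) (act (h b) x) \<in> V"
      using U(3)[of a] \<open>h a = h b\<close> by auto
  qed
qed

text \<open>The bound \<open>M\<close> keeps the sets \<open>S\<close> of successive stages in increasing blocks; the sets \<open>U\<close> shrink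
  to the recurrent point.\<close>

lemma recurrence_chain:
  fixes f :: "'i \<Rightarrow> nat \<Rightarrow> 'b" and I :: "nat \<Rightarrow> 'i set"
  assumes minimal "\<And>k. finite (I k)"
    and f: "\<forall>k\<ge>1. \<forall>i\<in>I k. \<forall>n\<ge>k. f i n \<in> carrier A"
    and V: "openin (top_of_set X) V" "V \<noteq> {}"
  shows "\<exists>U S M. U 0 = V \<and> (\<forall>k. openin (top_of_set X) (U k) \<and> U k \<noteq> {} \<and>
    Suc k \<le> M k \<and> M k \<le> M (Suc k) \<and>
    finite (S (Suc k)) \<and> S (Suc k) \<noteq> {} \<and> S (Suc k) \<subseteq> {M k..<M (Suc k)} \<and>
    X \<inter> closure (U (Suc k)) \<subseteq> U k \<and>
    (\<forall>x\<in>U (Suc k). \<forall>y\<in>U (Suc k). dist x y < 1 / Suc k) \<and>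
    (\<forall>i\<in>I (Suc k). \<forall>x\<in>U (Suc k). act (finprod A (f i) (S (Suc k))) x \<in> U k))"
proof -
  \<comment> \<open>The bound \<open>Suc k \<le> M\<close> puts the next block at indices where the
    families from \<open>I (Suc k)\<close> take values in the group.\<close>
  define P where "P = (\<lambda>k (U, S :: nat set, M). (k = 0 \<longrightarrow> U = V) \<and>
      openin (top_of_set X) U \<and> U \<noteq> {} \<and> Suc k \<le> M)"
  define Q where "Q = (\<lambda>k (U, S :: nat set, M) (U', S', M'). M \<le> M' \<and> finite S' \<and> S' \<noteq> {} \<and> S' \<subseteq> {M..<M'} \<and>
      X \<inter> closure U' \<subseteq> U \<and> (\<forall>x\<in>U'. \<forall>y\<in>U'. dist x y < 1 / Suc k) \<and>
      (\<forall>i\<in>I (Suc k). \<forall>x\<in>U'. act (finprod A (f i) S') x \<in> U))"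
  have "\<exists>s. \<forall>k. P k (s k) \<and> Q k (s k) (s (Suc k))"
  proof (rule dependent_nat_choice)
    show "\<exists>s. P 0 s"
      \<comment> \<open>The empty set is a placeholder for \<open>S 0\<close>, which the conclusion
        never mentions. The bound 1 lets the first block start at index 1.\<close>
      using V by (intro exI[of _ "(V, {}, 1)"]) (simp add: P_def)
  next
    fix s :: "'x set \<times> nat set \<times> nat" and k :: nat assume "P k s"
    moreover obtain U S0 M where s: "s = (U, S0, M)" using prod_cases3 by blast
    ultimately have U: "openin (top_of_set X) U" "U \<noteq> {}" and M: "Suc k \<le> M" by (auto simp: P_def)
    have "\<exists>S y. finite S \<and> S \<noteq> {} \<and> S \<subseteq> {M..} \<and> y \<in> U \<and> (\<forall>i\<in>I (Suc k). act (finprod A (f i) S) y \<in> U)"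
      using M by (intro multiple_recurrence assms(1,2) U f[rule_format, of "Suc k"]) auto
    then obtain S y where S: "finite S" "S \<noteq> {}" "S \<subseteq> {M..}" and "y \<in> U"
      and y: "\<forall>i\<in>I (Suc k). act (finprod A (f i) S) y \<in> U" by (elim exE conjE) (rule that)
    define M' where "M' = Suc (Max S)"
    have "Max S \<in> S" using S(1,2) by simp
    then have "M \<le> M'" using S(3) by (auto simp: M'_def)
    have "S \<subseteq> {M..<M'}"
      using S(1,3) Max_ge[of S] by (auto simp: M'_def less_Suc_eq_le)
    \<comment> \<open>The points of \<open>U\<close> that all maps of this stage return to
      \<open>U\<close>. The next open set is a small ball around \<open>y\<close> whose closure in
      \<open>X\<close> stays inside \<open>W\<close>.\<close>
    define W where "W = U \<inter> ((\<Inter>i\<in>I (Suc k). X \<inter> act (finprod A (f i) S) -` U) \<inter> X)"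
    have "y \<in> X" using \<open>y \<in> U\<close> U(1) openin_imp_subset by blast
    then have "y \<in> W" using \<open>y \<in> U\<close> y by (simp add: W_def)
    have "f i \<in> S \<rightarrow> carrier A" if "i \<in> I (Suc k)" for i
      using f[rule_format, OF _ that] S(3) M by fastforce
    then have "openin (top_of_set X) ((\<Inter>i\<in>I (Suc k). X \<inter> act (finprod A (f i) S) -` U) \<inter> topspace (top_of_set X))"
      using assms(2) U(1) by (intro openin_INT openin_act_preimage) auto
    then have "openin (top_of_set X) W"
      unfolding W_def using U(1) by (auto intro!: openin_Int simp del: INT_simps)
    then obtain e where e: "e > 0" "cball y e \<inter> X \<subseteq> W"
      using \<open>y \<in> W\<close> unfolding openin_contains_cball by blast
    \<comment> \<open>Half of \<open>1 / Suc k\<close>, so that any two points of the open ball are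
      at distance less than \<open>1 / Suc k\<close>.\<close>
    define r where "r = min e (1 / (2 * Suc k))"
    have "r > 0" using e by (simp add: r_def)
    define U' where "U' = X \<inter> ball y r"
    have "closure U' \<subseteq> cball y r"
      unfolding U'_def by (rule closure_minimal) auto
    moreover have "cball y r \<subseteq> cball y e" by (auto simp: r_def)
    ultimately have clos: "X \<inter> closure U' \<subseteq> W"
      using e(2) by blast
    then have "U' \<subseteq> W" using closure_subset[of U'] by (auto simp: U'_def)
    have "dist x z < 1 / Suc k" if "x \<in> U'" "z \<in> U'" for x z
    proof -
      have "dist x z < r + r" using that dist_triangle_less_add[of x y r z r]
        by (simp add: U'_def dist_commute)
      also have "\<dots> \<le> 1 / Suc k" by (simp add: r_def min_def field_simps)
      finally show ?thesis .
    qed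
    moreover have "openin (top_of_set X) U'" "y \<in> U'"
      using \<open>r > 0\<close> \<open>y \<in> X\<close> by (auto simp: U'_def)
    moreover have "\<forall>i\<in>I (Suc k). \<forall>x\<in>U'. act (finprod A (f i) S) x \<in> U"
      using \<open>U' \<subseteq> W\<close> unfolding W_def by blast
    moreover have "X \<inter> closure U' \<subseteq> U" using clos by (auto simp: W_def)
    moreover have "Suc (Suc k) \<le> M'" using \<open>Max S \<in> S\<close> S(3) M by (auto simp: M'_def)
    ultimately show "\<exists>s'. P (Suc k) s' \<and> Q k s s'"
      using S(1,2) \<open>S \<subseteq> {M..<M'}\<close> \<open>M \<le> M'\<close> unfolding s
      by (intro exI[of _ "(U', S, M')"]) (auto simp: P_def Q_def)
  qed
  then obtain s where s: "\<And>k. P k (s k)" "\<And>k. Q k (s k) (s (Suc k))" by blast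
  define U S M where "U k = fst (s k)" and "S k = fst (snd (s k))" and "M k = snd (snd (s k))" for k
  have sk: "s k = (U k, S k, M k)" for k by (simp add: U_def S_def M_def)
  have "U 0 = V" using s(1)[of 0] by (simp add: sk P_def)
  moreover have "openin (top_of_set X) (U k) \<and> U k \<noteq> {} \<and> Suc k \<le> M k" for k
    using s(1)[of k] by (simp add: sk P_def)
  moreover have "M k \<le> M (Suc k) \<and>
    finite (S (Suc k)) \<and> S (Suc k) \<noteq> {} \<and> S (Suc k) \<subseteq> {M k..<M (Suc k)} \<and>
    X \<inter> closure (U (Suc k)) \<subseteq> U k \<and>
    (\<forall>x\<in>U (Suc k). \<forall>y\<in>U (Suc k). dist x y < 1 / Suc k) \<and>
    (\<forall>i\<in>I (Suc k). \<forall>x\<in>U (Suc k). act (finprod A (f i) (S (Suc k))) x \<in> U k)" for k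
    using s(2)[of k] by (simp add: sk Q_def)
  ultimately show ?thesis by (intro exI[of _ U] exI[of _ S] exI[of _ M]) simp
qed

text \<open>Stage \<open>k\<close> treats all of the finitely many indices in \<open>I k\<close> at
  once. Hence the bound \<open>K\<close> depends only on \<open>e\<close> and serves every choice
  function \<open>c\<close>.\<close>

theorem uniform_recurrence:
  fixes f :: "'i \<Rightarrow> nat \<Rightarrow> 'b" and I :: "nat \<Rightarrow> 'i set"
  assumes minimal "\<And>k. finite (I k)"
    and f: "\<forall>k\<ge>1. \<forall>i\<in>I k. \<forall>n\<ge>k. f i n \<in> carrier A"
    and V: "openin (top_of_set X) V" "V \<noteq> {}"
  obtains x S where "x \<in> V"
    and "\<And>k. k \<ge> 1 \<Longrightarrow> finite (S k)" "\<And>k. k \<ge> 1 \<Longrightarrow> S k \<noteq> {}" "\<And>k. k \<ge> 1 \<Longrightarrow> S k \<subseteq> {k..}"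
    and "\<And>j k a b. 1 \<le> j \<Longrightarrow> j < k \<Longrightarrow> a \<in> S j \<Longrightarrow> b \<in> S k \<Longrightarrow> a < b"
    and "\<And>e. e > 0 \<Longrightarrow> \<exists>K. \<forall>F c. finite F \<and> F \<subseteq> {K<..} \<and> (\<forall>k\<in>F. c k \<in> I k) \<longrightarrow>
      dist (act (finprod A (\<lambda>k. finprod A (f (c k)) (S k)) F) x) x < e"
proof -
  note chain = recurrence_chain[OF assms]
  obtain U S M where U0: "U 0 = V" and *: "\<forall>k. openin (top_of_set X) (U k) \<and> U k \<noteq> {} \<and>
    Suc k \<le> M k \<and> M k \<le> M (Suc k) \<and>
    finite (S (Suc k)) \<and> S (Suc k) \<noteq> {} \<and> S (Suc k) \<subseteq> {M k..<M (Suc k)} \<and>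
    X \<inter> closure (U (Suc k)) \<subseteq> U k \<and>
    (\<forall>x\<in>U (Suc k). \<forall>y\<in>U (Suc k). dist x y < 1 / Suc k) \<and>
    (\<forall>i\<in>I (Suc k). \<forall>x\<in>U (Suc k). act (finprod A (f i) (S (Suc k))) x \<in> U k)"
    using chain by (elim exE conjE) (rule that)
  have U: "openin (top_of_set X) (U k)" "U k \<noteq> {}" for k using * by blast+
  have M: "Suc k \<le> M k" "M k \<le> M (Suc k)" for k using * by blast+
  have S: "finite (S (Suc k))" "S (Suc k) \<noteq> {}" "S (Suc k) \<subseteq> {M k..<M (Suc k)}" for k using * by blast+
  have clos: "X \<inter> closure (U (Suc k)) \<subseteq> U k" for k using * by blast
  have diam: "dist x y < 1 / Suc k" if "x \<in> U (Suc k)" "y \<in> U (Suc k)" for k x y using * that by blast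
  have ret: "act (finprod A (f i) (S (Suc k))) x \<in> U k" if "i \<in> I (Suc k)" "x \<in> U (Suc k)" for k i x
    using * that by blast
  have UX: "U k \<subseteq> X" for k using U(1) openin_imp_subset by blast
  have "U (Suc k) \<subseteq> U k" for k using clos[of k] UX closure_subset by blast
  then have dec: "U k \<subseteq> U j" if "j \<le> k" for j k
    using that by (rule lift_Suc_antimono_le)
  have "(\<Inter>k. X \<inter> closure (U k)) \<noteq> {}"
  proof (rule compact_space_imp_nest)
    show "compact_space (top_of_set X)" using compact_X by (simp add: compact_space_subtopology)
    show "closedin (top_of_set X) (X \<inter> closure (U k))" for k by (simp add: closedin_closed_Int)
    show "X \<inter> closure (U k) \<noteq> {}" for k using U(2)[of k] UX[of k] closure_subset by blast
    show "decseq (\<lambda>k. X \<inter> closure (U k))"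
      using dec by (intro decseq_SucI Int_mono closure_mono) auto
  qed
  then obtain x where "x \<in> (\<Inter>k. X \<inter> closure (U k))" by blast
  \<comment> \<open>Each closure lies inside the preceding open set, so \<open>x\<close> belongs to
    the open sets themselves.\<close>
  then have x: "x \<in> U k" for k using clos[of k] by blast
  have Sk: "finite (S k)" "S k \<noteq> {}" "S k \<subseteq> {M (k - 1)..<M k}" if "k \<ge> 1" for k
    using S[of "k - 1"] that by simp_all
  have Mmono: "M j \<le> M k" if "j \<le> k" for j k
    using M(2) that by (rule lift_Suc_mono_le)
  have fS: "f i \<in> S k \<rightarrow> carrier A" if "k \<ge> 1" "i \<in> I k" for i k
    using f[rule_format, OF that] Sk(3)[OF that(1)] M(1)[of "k - 1"] that(1) by fastforce
  \<comment> \<open>The largest index \<open>n\<close> acts first and moves the point from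
    \<open>U n\<close> into the preceding set. The other indices are at most \<open>n - 1\<close>,
    so the induction continues from there.\<close>
  have "act (finprod A (\<lambda>k. finprod A (f (c k)) (S k)) F) y \<in> U j"
    if "finite F" "F \<subseteq> {j<..b}" "\<forall>k\<in>F. c k \<in> I k" "y \<in> U b" "j \<le> b" for F c y j b
    using that
  proof (induction F arbitrary: y b rule: finite_linorder_max_induct)
    case empty
    have "y \<in> X" using empty.prems(3) UX by blast
    then show ?case using empty.prems(3,4) dec[of j b] act_one by auto
  next
    case (insert n F)
    let ?p = "\<lambda>k. finprod A (f (c k)) (S k)"
    have p: "?p k \<in> carrier A" if "k \<in> insert n F" for k
      using insert.prems that by (intro finprod_closed fS) auto
    have pF: "?p \<in> F \<rightarrow> carrier A" using p by blast
    have n: "j < n" "n \<le> b" using insert.prems by auto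
    then obtain n' where n': "n = Suc n'" by (cases n) auto
    have "y \<in> U n" using insert.prems dec n by blast
    then have "act (?p n) y \<in> U n'" using ret insert.prems(2) n' by simp
    moreover have "F \<subseteq> {j<..n'}" using insert.hyps(2) insert.prems(1) n' by fastforce
    ultimately have "act (finprod A ?p F) (act (?p n) y) \<in> U j"
      using insert.prems insert.IH[of n'] n n' by simp
    moreover have "finprod A ?p (insert n F) = finprod A ?p F \<otimes> ?p n"
      using insert.hyps pF p[of n] by (subst finprod_insert) (auto intro: m_comm)
    moreover have "y \<in> X" using \<open>y \<in> U n\<close> UX by blast
    ultimately show ?case
      using pF p[of n] by (simp add: act_mult)
  qed
  note ret_F = this
  show ?thesis
  proof (rule that[of x S])
    show "x \<in> V" using x[of 0] U0 by simp
    show "finite (S k)" "S k \<noteq> {}" if "k \<ge> 1" for k using Sk that by auto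
    show "S k \<subseteq> {k..}" if "k \<ge> 1" for k using Sk(3)[OF that] M(1)[of "k - 1"] that by fastforce
    show "a < b" if "1 \<le> j" "j < k" "a \<in> S j" "b \<in> S k" for j k a b
      using Sk(3)[of j] Sk(3)[of k] Mmono[of j "k - 1"] that by fastforce
    fix e :: real assume "e > 0"
    then obtain K where K: "1 / Suc K < e" using nat_approx_posE by blast
    show "\<exists>K. \<forall>F c. finite F \<and> F \<subseteq> {K<..} \<and> (\<forall>k\<in>F. c k \<in> I k) \<longrightarrow>
      dist (act (finprod A (\<lambda>k. finprod A (f (c k)) (S k)) F) x) x < e"
    proof (intro exI allI impI, elim conjE)
      fix F c assume F: "finite F" "F \<subseteq> {Suc K<..}" "\<forall>k\<in>F. c k \<in> I k"
      \<comment> \<open>Including \<open>Suc K\<close> covers empty \<open>F\<close>. Both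
        \<open>x\<close> and its image lie in \<open>U (Suc K)\<close>, whose points are less than
        \<open>1 / Suc K\<close> apart.\<close>
      define b where "b = Max (insert (Suc K) F)"
      have "F \<subseteq> {Suc K<..b}" "Suc K \<le> b" using F(1,2) by (auto simp: b_def)
      then have "act (finprod A (\<lambda>k. finprod A (f (c k)) (S k)) F) x \<in> U (Suc K)"
        using ret_F F(1,3) x by blast
      then show "dist (act (finprod A (\<lambda>k. finprod A (f (c k)) (S k)) F) x) x < e"
        using diam x K less_trans by blast
    qed
  qed
qed

text \<open>Zorn's lemma is applied to complements, where a minimal closed invariant set becomes a
  maximal open set and compactness becomes a statement about covers.\<close>

lemma exists_minimal_subset:
  assumes "X \<noteq> {}"
  obtains Y where "Y \<noteq> {}" "Y \<subseteq> X" "comm_action A Y act" "comm_action.minimal A Y act"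
proof -
  \<comment> \<open>These are the complements of the nonempty closed invariant subsets.\<close>
  define \<A> where "\<A> = {U. openin (top_of_set X) U \<and> U \<noteq> X \<and> (\<forall>h\<in>carrier A. \<forall>x\<in>X - U. act h x \<notin> U)}"
  have "\<exists>U\<in>\<A>. \<forall>U'\<in>\<A>. U \<subseteq> U' \<longrightarrow> U' = U"
  proof (rule subset_Zorn_nonempty)
    show "\<A> \<noteq> {}" using assms by (auto simp: \<A>_def intro!: exI[of _ "{}"])
  next
    fix \<C> assume \<C>: "\<C> \<noteq> {}" "subset.chain \<A> \<C>"
    then have sub: "\<C> \<subseteq> \<A>" by (simp add: subset_chain_def)
    have op: "\<forall>U\<in>\<C>. openin (top_of_set X) U" using sub by (auto simp: \<A>_def)
    have "\<Union>\<C> \<noteq> X"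
    proof
      assume "\<Union>\<C> = X"
      then have "\<exists>\<D>\<subseteq>\<C>. finite \<D> \<and> X \<subseteq> \<Union>\<D>"
        using op by (intro compact_X[unfolded compact_eq_openin_cover, THEN spec, THEN mp]) auto
      then obtain \<D> where \<D>: "\<D> \<subseteq> \<C>" "finite \<D>" "X \<subseteq> \<Union>\<D>" by blast
      have chain: "subset.chain \<A> \<D>"
        unfolding subset_chain_def
      proof (intro conjI ballI)
        show "\<D> \<subseteq> \<A>" using \<D>(1) sub by (rule subset_trans)
        fix P Q assume "P \<in> \<D>" "Q \<in> \<D>"
        then have "P \<in> \<C>" "Q \<in> \<C>" using \<D>(1) by auto
        then show "P \<subseteq> Q \<or> Q \<subseteq> P" using \<C>(2) by (simp add: subset_chain_def)
      qed
      have "\<D> \<noteq> {}" using \<D>(3) assms by blast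
      \<comment> \<open>A finite chain contains its union, so a chain covering \<open>X\<close>
        would have \<open>X\<close> itself as a member, which \<open>\<A>\<close> excludes.\<close>
      then have "\<Union>\<D> \<in> \<D>"
        using \<D>(2) chain by (intro Union_in_chain)
      then have "\<Union>\<D> \<in> \<A>" using \<D>(1) sub by blast
      moreover have "\<Union>\<D> = X" using \<D>(1,3) \<open>\<Union>\<C> = X\<close> by blast
      ultimately show False by (simp add: \<A>_def)
    qed
    moreover have "openin (top_of_set X) (\<Union>\<C>)" using op by blast
    ultimately show "\<Union>\<C> \<in> \<A>" using sub by (auto simp: \<A>_def)
  qed
  then obtain U where U: "U \<in> \<A>" and max: "\<And>U'. U' \<in> \<A> \<Longrightarrow> U \<subseteq> U' \<Longrightarrow> U' = U" by blast
  define Y where "Y = X - U"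
  have UX: "U \<subseteq> X" using U openin_imp_subset by (auto simp: \<A>_def)
  have Y: "Y \<noteq> {}" "Y \<subseteq> X" using U UX by (auto simp: Y_def \<A>_def)
  have clY: "closedin (top_of_set X) Y"
    using U unfolding Y_def \<A>_def by (auto intro: closedin_diff)
  have act_Y: "act h x \<in> Y" if "h \<in> carrier A" "x \<in> Y" for h x
    using U that act_in by (auto simp: Y_def \<A>_def)
  interpret Y: comm_action A Y act
  proof unfold_locales
    show "compact Y" using clY compact_X by (rule closedin_compact[rotated])
  qed (use Y act_Y act_mult act_one in \<open>auto intro: continuous_on_subset[OF act_cont]\<close>)
  have Y.minimal
    unfolding Y.minimal_def
  proof (intro allI impI, elim conjE)
    fix C assume C: "closedin (top_of_set Y) C" "C \<noteq> {}" "\<forall>h\<in>carrier A. act h ` C \<subseteq> C"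
    have CY: "C \<subseteq> Y" using C(1) closedin_imp_subset by blast
    have "closedin (top_of_set X) C" using C(1) clY by (rule closedin_trans)
    then have "openin (top_of_set X) (X - C)" by (auto intro: openin_diff)
    moreover have "X - C \<noteq> X" using C(2) CY Y(2) by blast
    ultimately have "X - C \<in> \<A>"
      using C(3) act_in CY Y(2) by (auto simp: \<A>_def)
    then have "X - C = U" using CY UX by (intro max) (auto simp: Y_def)
    then show "C = Y" using CY Y(2) by (auto simp: Y_def)
  qed
  then show ?thesis using that Y Y.comm_action_axioms by blast
qed

end

section \<open>Variable words and extractions\<close>

lemma Ltilde0D:
  assumes "v \<in> Ltilde0"
  shows "finite (dom v)" "dom v \<noteq> {}" "0 \<notin> dom v" "dom_pos v \<noteq> {}"
    and "\<exists>t\<in>dom_neg v. v t = Some Var" "\<exists>t\<in>dom_pos v. v t = Some Var"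
    and "t \<in> dom v \<Longrightarrow> v t = Some Var \<or> (\<exists>k. v t = Some (Num k) \<and> 1 \<le> k \<and> int k \<le> \<bar>t\<bar>)"
  using assms unfolding Ltilde0_def by blast+

lemma map_add_in_Ltilde0:
  assumes "v \<in> Ltilde0" "v' \<in> Ltilde0"
  shows "v ++ v' \<in> Ltilde0"
proof -
  have eq: "(v ++ v') t = v' t" if "t \<in> dom v'" for t
    using that by (rule map_add_dom_app_simps(1))
  have eq': "(v ++ v') t = v t" if "t \<notin> dom v'" for t
    using that by (rule map_add_dom_app_simps(3))
  have "(v ++ v') t = Some Var \<or> (\<exists>k. (v ++ v') t = Some (Num k) \<and> 1 \<le> k \<and> int k \<le> \<bar>t\<bar>)"
    if "t \<in> dom (v ++ v')" for t
  proof (cases "t \<in> dom v'")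
    case True
    then show ?thesis using Ltilde0D(7)[OF assms(2) True] by (simp only: eq)
  next
    case False
    then have "t \<in> dom v" using that by (auto simp: domIff map_add_def)
    from Ltilde0D(7)[OF assms(1) this] show ?thesis by (simp only: eq'[OF False])
  qed
  moreover have "\<exists>t\<in>dom_neg (v ++ v'). (v ++ v') t = Some Var"
  proof -
    obtain t where "t \<in> dom_neg v'" "v' t = Some Var" using Ltilde0D(5)[OF assms(2)] by blast
    then show ?thesis using eq[of t] by (intro bexI[of _ t]) (auto simp: dom_neg_def)
  qed
  moreover have "\<exists>t\<in>dom_pos (v ++ v'). (v ++ v') t = Some Var"
  proof -
    obtain t where "t \<in> dom_pos v'" "v' t = Some Var" using Ltilde0D(6)[OF assms(2)] by blast
    then show ?thesis using eq[of t] by (intro bexI[of _ t]) (auto simp: dom_pos_def)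
  qed
  moreover have "finite (dom (v ++ v'))" "dom (v ++ v') \<noteq> {}" "0 \<notin> dom (v ++ v')"
    using Ltilde0D(1-3)[OF assms(1)] Ltilde0D(1-3)[OF assms(2)] unfolding dom_map_add by blast+
  ultimately show ?thesis unfolding Ltilde0_def by (intro CollectI conjI ballI)
qed

lemma join_in_Ltilde0:
  assumes "finite S" "S \<noteq> {}" "\<And>n. n \<in> S \<Longrightarrow> v n \<in> Ltilde0"
  shows "join v S \<in> Ltilde0"
  using assms
proof (induction S rule: finite_linorder_max_induct)
  case (insert n S)
  then show ?case
    by (cases "S = {}") (auto simp: join_insert map_add_in_Ltilde0)
qed simp

lemma subst_in_Ltilde:
  assumes "v \<in> Ltilde0" "1 \<le> a" "1 \<le> b"
    and "\<And>t. t \<in> dom v \<Longrightarrow> int a \<le> \<bar>t\<bar> \<and> int b \<le> \<bar>t\<bar>"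
  shows "subst v (Num a) (Num b) \<in> Ltilde"
proof -
  have "\<exists>k. subst v (Num a) (Num b) t = Some (Num k) \<and> 1 \<le> k \<and> int k \<le> \<bar>t\<bar>" if "t \<in> dom v" for t
    using Ltilde0D(7)[OF assms(1) that] assms(2,3) assms(4)[OF that]
    by (auto simp: subst_def)
  then show ?thesis
    using Ltilde0D(1-3)[OF assms(1)] unfolding Ltilde_def by (simp del: dom_eq_empty_conv)
qed

section \<open>Nesting and growth of positions along a sequence of variable words\<close>

lemma nested_subset: "nested v S \<Longrightarrow> R \<subseteq> S \<Longrightarrow> nested v R"
  unfolding nested_def by blast

lemma nested_Qinf:
  assumes "w \<in> Qinf"
  shows "nested w {1..}"
  unfolding nested_def
proof (intro ballI impI)
  fix n k :: nat assume "n \<in> {1..}" "n < k"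
  have step: "encl (dom (w k)) (dom (w (Suc k)))" if "k \<ge> 1" for k
  proof -
    have "w k \<in> Ltilde0" "w (Suc k) \<in> Ltilde0" "R1_less (w k) (w (Suc k))"
      using assms that by (auto simp: Qinf_def)
    then show ?thesis
      by (simp only: R1_less_iff_encl Ltilde0D(1,2) simp_thms)
  qed
  have "encl (dom (w n)) (dom (w (Suc (n + d))))" for d
  proof (induction d)
    case 0
    then show ?case using step[of n] \<open>n \<in> {1..}\<close> by simp
  next
    case (Suc d)
    then show ?case using step[of "Suc (n + d)"] by (auto intro: encl_trans)
  qed
  then show "encl (dom (w n)) (dom (w k))"
    using \<open>n < k\<close> less_iff_Suc_add by auto
qed

text \<open>Each word has positions of both signs and the next word lies outside them, so every step
  moves at least one further away from 0. This makes all letters up to \<open>n\<close> legal at the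
  positions of \<open>w n\<close>.\<close>

lemma Qinf_abs_ge:
  assumes "w \<in> Qinf" "n \<ge> 1" "t \<in> dom (w n)"
  shows "int n \<le> \<bar>t\<bar>"
  using assms(2,3)
proof (induction n arbitrary: t rule: dec_induct)
  case base
  have "w 1 \<in> Ltilde0" using assms(1) by (simp add: Qinf_def)
  then have "t \<noteq> 0" using base Ltilde0D(3) by metis
  then show ?case by simp
next
  case (step n)
  have "encl (dom (w n)) (dom (w (Suc n)))"
    using nested_Qinf[OF assms(1)] step.hyps by (simp add: nested_def)
  then have t: "(\<forall>s\<in>dom (w n). t < s) \<or> (\<forall>s\<in>dom (w n). s < t)"
    using step.prems unfolding encl_def by blast
  have wn: "w n \<in> Ltilde0" using assms(1) step.hyps by (simp add: Qinf_def)
  obtain a where a: "a \<in> dom (w n)" "a < 0"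
    using Ltilde0D(5)[OF wn] by (auto simp: dom_neg_def)
  obtain b where b: "b \<in> dom (w n)" "b > 0"
    using Ltilde0D(6)[OF wn] by (auto simp: dom_pos_def)
  have "t < a \<or> b < t" using t a(1) b(1) by blast
  then show ?case using step.IH[OF a(1)] step.IH[OF b(1)] a(2) b(2) by auto
qed

lemma encl_dom_joins:
  assumes "finite R" "R \<noteq> {}" "finite S" "S \<noteq> {}"
    and "\<And>a b. a \<in> R \<Longrightarrow> b \<in> S \<Longrightarrow> a < b" "nested v (R \<union> S)"
  shows "encl (dom (join v R)) (dom (join v S))"
proof -
  have each: "encl (dom (join v R)) (dom (v b))" if "b \<in> S" for b
    using assms that by (intro encl_dom_join nested_subset[OF assms(6)]) auto
  obtain b where b: "b \<in> S" using assms(4) by blast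
  show ?thesis
    using each[OF b] each b unfolding dom_join[OF assms(3)] encl_def by (meson UN_E UN_I)
qed

lemma extraction_join:
  assumes w: "w \<in> Qinf"
    and S: "\<And>k. k \<ge> 1 \<Longrightarrow> finite (S k)" "\<And>k. k \<ge> 1 \<Longrightarrow> S k \<noteq> {}" "\<And>k. k \<ge> 1 \<Longrightarrow> S k \<subseteq> {k..}"
    and blocks: "\<And>j k a b. 1 \<le> j \<Longrightarrow> j < k \<Longrightarrow> a \<in> S j \<Longrightarrow> b \<in> S k \<Longrightarrow> a < b"
  shows "extraction (\<lambda>k. join w (S k)) w"
  unfolding extraction_def
proof (intro conjI allI impI)
  have w0: "w n \<in> Ltilde0" if "n \<ge> 1" for n using w that by (simp add: Qinf_def)
  have S1: "S k \<subseteq> {1..}" if "k \<ge> 1" for k using S(3)[OF that] that by force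
  have in_L: "join w (S k) \<in> Ltilde0" if "k \<ge> 1" for k
    using S(1,2)[OF that] S1[OF that] w0 by (intro join_in_Ltilde0) auto
  have "encl (dom (join w (S k))) (dom (join w (S (Suc k))))" if "k \<ge> 1" for k
    using S(1,2)[of k] S(1,2)[of "Suc k"] S1[of k] S1[of "Suc k"] blocks[of k "Suc k"] that
    by (intro encl_dom_joins nested_subset[OF nested_Qinf[OF w]]) auto
  then show "(\<lambda>k. join w (S k)) \<in> Qinf"
    using in_L Ltilde0D(1,2)[OF in_L] by (auto simp: Qinf_def R1_less_iff_encl simp del: domIff)
  fix k :: nat assume k: "k \<ge> 1"
  show "\<exists>ns c. ns \<noteq> [] \<and> sorted_wrt (<) ns \<and> (\<forall>n\<in>set ns. 1 \<le> n) \<and>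
        (\<forall>n\<in>set ns. c n \<in> {(Num a, Num b) | a b. a \<in> {1..n} \<and> b \<in> {1..n}} \<union> {(Var, Var)}) \<and>
        (\<exists>n\<in>set ns. c n = (Var, Var)) \<and>
        join w (S k) = star_list (map (\<lambda>n. subst (w n) (fst (c n)) (snd (c n))) ns)"
    using S(1,2)[OF k] S1[OF k]
    \<comment> \<open>Choosing the pair \<open>(Var, Var)\<close> at every index leaves each
      \<open>w n\<close> unchanged.\<close>
    by (intro exI[of _ "sorted_list_of_set (S k)"] exI[of _ "\<lambda>_. (Var, Var)"])
      (auto simp: join_def)
qed

section \<open>Systems of transformations as group actions\<close>

lemma comm_action_homeo:
  assumes "compact X" "comm_homeo_group X G"
  shows "comm_action ((BijGroup X)\<lparr>carrier := G\<rparr>) X (\<lambda>h. h)"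
proof -
  let ?A = "(BijGroup X)\<lparr>carrier := G\<rparr>"
  have G: "subgroup G (BijGroup X)" "comm_group ?A" "\<forall>f\<in>G. \<exists>h. homeomorphism X X f h"
    using assms(2) by (auto simp: comm_homeo_group_def)
  then have GB: "G \<subseteq> Bij X" using subgroup.subset by (fastforce simp: BijGroup_def)
  interpret A: comm_group ?A by (rule G(2))
  show ?thesis
  proof unfold_locales
    show "compact X" by fact
    show "h x \<in> X" if "h \<in> carrier ?A" "x \<in> X" for h x
      using GB that Bij_imp_funcset by fastforce
    show "continuous_on X h" if "h \<in> carrier ?A" for h
      using G(3) that by (auto dest: homeomorphism_cont1)
    show "(h \<otimes>\<^bsub>?A\<^esub> k) x = h (k x)" if "h \<in> carrier ?A" "k \<in> carrier ?A" "x \<in> X" for h k x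
      using GB that by (auto simp: BijGroup_def compose_def subset_iff)
    show "\<one>\<^bsub>?A\<^esub> x = x" if "x \<in> X" for x
      using that by (simp add: BijGroup_def)
  qed
qed

text \<open>The word of the largest index encloses the concatenation of the others, so the law of
  the system applies at every step of the induction. The induction starts at singletons, since the
  empty word has value 0.\<close>

lemma finprod_Q_system:
  assumes "Q_system X T" "comm_homeo_group X G" "\<And>q. q \<noteq> 0 \<Longrightarrow> restrict (T q) X \<in> G"
    and "finite S" "S \<noteq> {}" "\<And>n. n \<in> S \<Longrightarrow> v n \<in> Ltilde" "nested v S"
  shows "finprod ((BijGroup X)\<lparr>carrier := G\<rparr>) (\<lambda>n. restrict (T (g (v n))) X) S
    = restrict (T (g (join v S))) X"
proof -
  let ?A = "(BijGroup X)\<lparr>carrier := G\<rparr>"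
  let ?f = "\<lambda>n. restrict (T (g (v n))) X"
  have G: "subgroup G (BijGroup X)" "comm_group ?A"
    using assms(2) by (auto simp: comm_homeo_group_def)
  then have GB: "G \<subseteq> Bij X" using subgroup.subset by (fastforce simp: BijGroup_def)
  interpret A: comm_group ?A by (rule G(2))
  show ?thesis
    using assms(4-)
  proof (induction S rule: finite_linorder_max_induct)
    case (insert n S)
    have fc: "?f k \<in> carrier ?A" if "k \<in> insert n S" for k
      using insert.prems(2)[OF that] assms(3) g_neq_0 by simp
    show ?case
    proof (cases "S = {}")
      case True
      then have "finprod ?A ?f (insert n S) = ?f n \<otimes>\<^bsub>?A\<^esub> finprod ?A ?f {}"
        using fc by (simp only: A.finprod_insert[OF finite.emptyI] empty_iff not_False_eq_True Pi_empty UNIV_I insertI1)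
      also have "\<dots> = ?f n" using fc[of n] by (simp only: A.finprod_empty A.r_one insertI1)
      finally show ?thesis by (simp only: True join_singleton)
    next
      case False
      have IH: "finprod ?A ?f S = restrict (T (g (join v S))) X"
        by (rule insert.IH) (use insert.prems False in \<open>auto simp: nested_def\<close>)
      have L: "join v S \<in> Ltilde" "v n \<in> Ltilde"
        using insert False by (auto intro!: join_in_Ltilde)
      have enc: "encl (dom (join v S)) (dom (v n))"
        using insert False by (intro encl_dom_join) auto
      have sum: "g (join v (insert n S)) = g (join v S) + g (v n)"
        using insert L enc by (simp add: join_insert g_map_add encl_disjoint)
      have "R1_less_rat (g (join v S)) (g (v n))"
        using enc L LtildeD(1,2)[OF L(1)] LtildeD(1)[OF L(2)]
        by (simp add: R1_less_rat_def g_inv_g R1_less_iff_encl)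
      then have T: "T (g (join v S)) (T (g (v n)) x) = T (g (join v (insert n S))) x" if "x \<in> X" for x
        using assms(1) that g_neq_0 L unfolding Q_system_def sum by blast
      have "finprod ?A ?f (insert n S) = ?f n \<otimes>\<^bsub>?A\<^esub> finprod ?A ?f S"
        using insert.hyps fc by (intro A.finprod_insert) auto
      \<comment> \<open>The law of the system has the inner word's map on the left, so commutativity
        is used to put the outermost word's map on the right.\<close>
      also have "\<dots> = finprod ?A ?f S \<otimes>\<^bsub>?A\<^esub> ?f n"
        using fc by (intro A.m_comm A.finprod_closed) auto
      also have "\<dots> = compose X (restrict (T (g (join v S))) X) (?f n)"
      proof -
        have "restrict (T (g (join v S))) X \<in> Bij X" "?f n \<in> Bij X"
          using assms(3) g_neq_0 L GB by blast+
        then show ?thesis unfolding IH by (simp add: BijGroup_def)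
      qed
      also have "\<dots> = restrict (T (g (join v (insert n S)))) X"
      proof
        fix x
        have "T (g (v n)) x \<in> X" if "x \<in> X"
          using assms(1) g_neq_0[OF L(2)] that by (auto simp: Q_system_def)
        then show "compose X (restrict (T (g (join v S))) X) (?f n) x = restrict (T (g (join v (insert n S)))) X x"
          using T[of x] by (simp add: compose_def)
      qed
      finally show ?thesis .
    qed
  qed simp
qed

text \<open>For existence, \<open>Y\<close> is a minimal subset of \<open>X\<close>; for density, \<open>Y = X\<close>.\<close>

lemma exists_recurrent_along:
  fixes X :: "'a::metric_space set"
  assumes "comm_homeo_group X G"
    and T: "\<And>i. i \<in> {1..m} \<Longrightarrow> Q_system X (T i)"
      "\<And>i q. i \<in> {1..m} \<Longrightarrow> q \<noteq> 0 \<Longrightarrow> restrict (T i q) X \<in> G"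
    and w: "w \<in> Qinf"
    and Y: "comm_action ((BijGroup X)\<lparr>carrier := G\<rparr>) Y (\<lambda>h. h)"
      "comm_action.minimal ((BijGroup X)\<lparr>carrier := G\<rparr>) Y (\<lambda>h. h)" "Y \<subseteq> X"
    and V: "openin (top_of_set Y) V" "V \<noteq> {}"
  shows "\<exists>x0\<in>V. \<exists>u. extraction u w \<and> recurrent_along m T u x0"
proof -
  let ?A = "(BijGroup X)\<lparr>carrier := G\<rparr>"
  interpret A: comm_action ?A Y "\<lambda>h. h" by (rule Y(1))
  have w0: "w n \<in> Ltilde0" if "n \<ge> 1" for n using w that by (simp add: Qinf_def)
  define f where "f = (\<lambda>(i, a, b) n. restrict (T i (g (subst (w n) (Num a) (Num b)))) X)"
  \<comment> \<open>The letters that may be substituted into \<open>u k\<close> are those up to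
    \<open>k\<close>. They are legal in every \<open>w n\<close> with \<open>n\<close> in
    \<open>S k\<close>, because \<open>S k \<subseteq> {k..}\<close>.\<close>
  define I where "I k = {1..m} \<times> {1..k} \<times> {1..k}" for k :: nat
  have sub_L: "subst (w n) (Num a) (Num b) \<in> Ltilde" if "1 \<le> a" "a \<le> n" "1 \<le> b" "b \<le> n" for n a b
    using that w0[of n] Qinf_abs_ge[OF w, of n] by (intro subst_in_Ltilde) force+
  have fG: "\<forall>k\<ge>1. \<forall>c\<in>I k. \<forall>n\<ge>k. f c n \<in> carrier ?A"
    using T(2) g_neq_0[OF sub_L] by (auto simp: f_def I_def)
  have finite_I: "\<And>k. finite (I k)" by (simp add: I_def)
  obtain x0 S where x0: "x0 \<in> V"
    and S: "\<And>k. k \<ge> 1 \<Longrightarrow> finite (S k)" "\<And>k. k \<ge> 1 \<Longrightarrow> S k \<noteq> {}" "\<And>k. k \<ge> 1 \<Longrightarrow> S k \<subseteq> {k..}"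
    and blocks: "\<And>j k a b. 1 \<le> j \<Longrightarrow> j < k \<Longrightarrow> a \<in> S j \<Longrightarrow> b \<in> S k \<Longrightarrow> a < b"
    and rec: "\<And>e. e > 0 \<Longrightarrow> \<exists>K. \<forall>F c. finite F \<and> F \<subseteq> {K<..} \<and> (\<forall>k\<in>F. c k \<in> I k) \<longrightarrow>
      dist (finprod ?A (\<lambda>k. finprod ?A (f (c k)) (S k)) F x0) x0 < e"
    by (rule A.uniform_recurrence[OF Y(2) finite_I fG V]) (rule that)
  define u where "u = (\<lambda>k. join w (S k))"
  have ext: "extraction u w" unfolding u_def by (rule extraction_join[OF w S blocks])
  then have u: "u \<in> Qinf" by (simp add: extraction_def)
  have u0: "u k \<in> Ltilde0" if "k \<ge> 1" for k using u that by (simp add: Qinf_def)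
  have "x0 \<in> X" using x0 V(1) Y(3) openin_imp_subset by blast
  \<comment> \<open>The components are swapped as in \<open>g_var\<close>: the second one goes to
    the positive positions.\<close>
  define v where "v s k = subst (u k) (Num (snd (s k))) (Num (fst (s k)))" for s :: "nat \<Rightarrow> nat \<times> nat" and k
  have eval: "eval_seq u s k = g (v s k)" for s k
    by (simp add: eval_seq_def g_var_def v_def)
  have v_nested: "nested (v s) {1..}" for s
    using nested_Qinf[OF u] by (simp add: nested_def v_def)
  have v_L: "v s k \<in> Ltilde" if "s \<in> admissible" "k \<ge> 1" for s k
    using that u0[of k] Qinf_abs_ge[OF u, of k] unfolding v_def admissible_def
    by (intro subst_in_Ltilde) force+
  have FS_eq: "(\<Sum>k\<in>F. eval_seq u s k) = g (join (v s) F)"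
    if "s \<in> admissible" "finite F" "F \<subseteq> {1..}" for s F
    unfolding eval using that v_L by (intro g_join[symmetric] nested_subset[OF v_nested]) auto
  \<comment> \<open>\<open>finprod_Q_system\<close> is used twice: inside each block
    \<open>S k\<close>, where the same letters are substituted into all words, and then across the
    indices in \<open>F\<close>.\<close>
  have T_eq: "T i (g (join (v s) F)) x0 = finprod ?A (\<lambda>k. finprod ?A (f (i, snd (s k), fst (s k))) (S k)) F x0"
    if i: "i \<in> {1..m}" and s: "s \<in> admissible" and F: "finite F" "F \<noteq> {}" "F \<subseteq> {1..}" for i s F
  proof -
    have "finprod ?A (f (i, snd (s k), fst (s k))) (S k) = restrict (T i (g (v s k))) X" if k: "k \<in> F" for k
    proof -
      have k1: "k \<ge> 1" using k F(3) by auto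
      have "\<And>n. n \<in> S k \<Longrightarrow> subst (w n) (Num (snd (s k))) (Num (fst (s k))) \<in> Ltilde"
        using S(3)[OF k1] s k1 by (intro sub_L) (fastforce simp: admissible_def)+
      moreover have "nested (\<lambda>n. subst (w n) (Num (snd (s k))) (Num (fst (s k)))) (S k)"
        using nested_Qinf[OF w] S(3)[OF k1] k1 unfolding nested_def by fastforce
      ultimately show ?thesis
        using finprod_Q_system[OF T(1)[OF i] assms(1) T(2)[OF i] S(1,2)[OF k1]]
        by (simp add: f_def v_def u_def subst_join S(1)[OF k1])
    qed
    moreover have "restrict (T i (g (v s k))) X \<in> carrier ?A" if "k \<in> F" for k
      using T(2)[OF i] g_neq_0 v_L[OF s, of k] F(3) that by auto
    ultimately have "finprod ?A (\<lambda>k. finprod ?A (f (i, snd (s k), fst (s k))) (S k)) F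
        = finprod ?A (\<lambda>k. restrict (T i (g (v s k))) X) F"
      by (intro A.finprod_cong') auto
    also have "\<dots> = restrict (T i (g (join (v s) F))) X"
      using F v_L[OF s] by (intro finprod_Q_system[OF T(1)[OF i] assms(1) T(2)[OF i]] nested_subset[OF v_nested]) auto
    finally show ?thesis using \<open>x0 \<in> X\<close> by simp
  qed
  \<comment> \<open>An admissible sequence is one choice function into the sets \<open>I k\<close>,
    so the uniformity over \<open>c\<close> becomes uniformity over \<open>s\<close>.\<close>
  have close: "\<exists>K. \<forall>i\<in>{1..m}. \<forall>s\<in>admissible. \<forall>F. finite F \<and> F \<noteq> {} \<and> F \<subseteq> {1..} \<and> F \<subseteq> {K<..} \<longrightarrow>
      dist (T i (g (join (v s) F)) x0) x0 < e" if e: "e > 0" for e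
  proof -
    obtain K where K: "\<forall>F c. finite F \<and> F \<subseteq> {K<..} \<and> (\<forall>k\<in>F. c k \<in> I k) \<longrightarrow>
      dist (finprod ?A (\<lambda>k. finprod ?A (f (c k)) (S k)) F x0) x0 < e" using rec[OF e] by blast
    show ?thesis
    proof (intro exI ballI allI impI, elim conjE)
      fix i s F assume i: "i \<in> {1..m}" and s: "s \<in> admissible"
        and F: "finite F" "F \<noteq> {}" "F \<subseteq> {1..}" "F \<subseteq> {K<..}"
      have "\<forall>k\<in>F. (i, snd (s k), fst (s k)) \<in> I k"
        using i s F(3) by (auto simp: I_def admissible_def)
      then show "dist (T i (g (join (v s) F)) x0) x0 < e"
        using K[rule_format, of F "\<lambda>k. (i, snd (s k), fst (s k))"] F T_eq[OF i s F(1-3)] by simp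
    qed
  qed
  have "recurrent_along m T u x0"
    unfolding recurrent_along_def
  proof (intro ballI conjI)
    fix i assume i: "i \<in> {1..m}"
    show "R1_lim_uniformly admissible (\<lambda>s. FS (eval_seq u s)) (\<lambda>q. T i q x0) x0"
      unfolding R1_lim_uniformly_def
    proof (intro allI impI, elim conjE)
      fix V' :: "'a set" assume "open V'" "x0 \<in> V'"
      then obtain e where e: "e > 0" "\<And>y. dist y x0 < e \<Longrightarrow> y \<in> V'" unfolding open_dist by blast
      obtain K where K: "\<forall>i\<in>{1..m}. \<forall>s\<in>admissible. \<forall>F. finite F \<and> F \<noteq> {} \<and> F \<subseteq> {1..} \<and> F \<subseteq> {K<..} \<longrightarrow>
        dist (T i (g (join (v s) F)) x0) x0 < e" using close[OF e(1)] by blast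
      have "finite (\<Union>k\<in>{1..K}. dom (u k))" using Ltilde0D(1)[OF u0] by auto
      \<comment> \<open>\<open>B\<close> bounds the positions of the first \<open>K\<close> words.
        If all positive positions of \<open>q\<close> exceed \<open>B\<close>, then none of these
        words occurs in \<open>q\<close>, so only indices above \<open>K\<close> contribute.\<close>
      then obtain B where B: "\<And>t. t \<in> (\<Union>k\<in>{1..K}. dom (u k)) \<Longrightarrow> t \<le> B"
        by (meson Max_ge)
      show "\<exists>n0\<ge>1. \<forall>s\<in>admissible. \<forall>q\<in>FS (eval_seq u s).
        int n0 \<le> min (- Max (dom_neg (g_inv q))) (Min (dom_pos (g_inv q))) \<longrightarrow> T i q x0 \<in> V'"
      proof (intro exI[of _ "Suc (nat B)"] conjI ballI impI)
        fix s q assume s: "s \<in> admissible" and "q \<in> FS (eval_seq u s)"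
          and n0: "int (Suc (nat B)) \<le> min (- Max (dom_neg (g_inv q))) (Min (dom_pos (g_inv q)))"
        then obtain F where F: "finite F" "F \<noteq> {}" "F \<subseteq> {1..}" "q = (\<Sum>k\<in>F. eval_seq u s k)"
          by (auto simp: FS_def)
        then have q: "q = g (join (v s) F)" using FS_eq s by simp
        have L: "join (v s) F \<in> Ltilde" using F(1-3) v_L[OF s] by (intro join_in_Ltilde) auto
        have "F \<subseteq> {K<..}"
        proof
          fix k assume k: "k \<in> F"
          show "k \<in> {K<..}"
          proof (rule ccontr)
            assume "k \<notin> {K<..}"
            then have kK: "k \<in> {1..K}" using k F(3) by auto
            then obtain t where t: "t \<in> dom_pos (u k)" using Ltilde0D(4)[OF u0] by fastforce
            then have "t \<le> B" using B kK unfolding dom_pos_def by blast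
            have "t \<in> dom_pos (g_inv q)"
              using t k unfolding q g_inv_g[OF L] dom_pos_def dom_join[OF F(1)] by (auto simp: v_def)
            moreover have "finite (dom_pos (g_inv q))"
              using LtildeD(1)[OF L] unfolding q g_inv_g[OF L] dom_pos_def by simp
            ultimately have "Min (dom_pos (g_inv q)) \<le> t" by simp
            then show False using n0 \<open>t \<le> B\<close> by (auto split: if_splits)
          qed
        qed
        then show "T i q x0 \<in> V'" unfolding q using K i s F(1-3) by (intro e(2)) simp
      qed simp
    qed
    show "uniform_limit admissible (\<lambda>n s. T i (eval_seq u s n) x0) (\<lambda>s. x0) sequentially"
      unfolding uniform_limit_iff
    proof (intro allI impI)
      fix e :: real assume "e > 0"
      then obtain K where K: "\<forall>i\<in>{1..m}. \<forall>s\<in>admissible. \<forall>F. finite F \<and> F \<noteq> {} \<and> F \<subseteq> {1..} \<and> F \<subseteq> {K<..} \<longrightarrow>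
        dist (T i (g (join (v s) F)) x0) x0 < e" using close by blast
      \<comment> \<open>A single term is the case of the finite sum over \<open>{n}\<close>.\<close>
      have "dist (T i (eval_seq u s n) x0) x0 < e" if "n \<ge> Suc K" "s \<in> admissible" for n s
        using K[rule_format, OF i that(2), of "{n}"] that(1) by (simp add: eval)
      then show "\<forall>\<^sub>F n in sequentially. \<forall>s\<in>admissible. dist (T i (eval_seq u s n) x0) x0 < e"
        unfolding eventually_sequentially by blast
    qed
  qed
  then show ?thesis using x0 ext by blast
qed

theorem theorem3p2:
  fixes X :: "'a::metric_space set"
    and m :: nat
    and T :: "nat \<Rightarrow> rat \<Rightarrow> 'a \<Rightarrow> 'a"
    and G :: "('a \<Rightarrow> 'a) set"
    and w :: "nat \<Rightarrow> lword"
  assumes "compact X" and "X \<noteq> {}"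
    and "m \<ge> 1"
    and "\<And>i. i \<in> {1..m} \<Longrightarrow> Q_system X (T i)"
    and "comm_homeo_group X G"
    and "\<And>i q. i \<in> {1..m} \<Longrightarrow> q \<noteq> 0 \<Longrightarrow> restrict (T i q) X \<in> G"
    and "w \<in> Qinf"
  shows "(\<exists>x0\<in>X. \<exists>u. extraction u w \<and> recurrent_along m T u x0) \<and>
         (minimal_action X G \<longrightarrow>
            X \<subseteq> closure {x0 \<in> X. \<exists>u. extraction u w \<and> recurrent_along m T u x0})"
proof -
  let ?A = "(BijGroup X)\<lparr>carrier := G\<rparr>"
  interpret A: comm_action ?A X "\<lambda>h. h"
    using assms(1,5) by (rule comm_action_homeo)
  obtain Y where Y: "Y \<noteq> {}" "Y \<subseteq> X" "comm_action ?A Y (\<lambda>h. h)" "comm_action.minimal ?A Y (\<lambda>h. h)"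
    using A.exists_minimal_subset[OF assms(2)] .
  have "\<exists>x0\<in>Y. \<exists>u. extraction u w \<and> recurrent_along m T u x0"
    using Y(1) by (intro exists_recurrent_along[OF assms(5,4,6,7) Y(3,4,2)]) auto
  moreover have "X \<subseteq> closure {x0 \<in> X. \<exists>u. extraction u w \<and> recurrent_along m T u x0}"
    if minimal: "minimal_action X G"
  proof
    fix x assume x: "x \<in> X"
    have "A.minimal"
      unfolding A.minimal_def
    proof (intro allI impI)
      fix C assume C: "closedin (top_of_set X) C \<and> C \<noteq> {} \<and> (\<forall>h\<in>carrier ?A. h ` C \<subseteq> C)"
      then have "\<not> C \<subset> X" using minimal unfolding minimal_action_def by auto
      then show "C = X" using C closedin_imp_subset by blast
    qed
    then have *: "\<exists>x0\<in>V. \<exists>u. extraction u w \<and> recurrent_along m T u x0"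
      if "openin (top_of_set X) V" "V \<noteq> {}" for V
      using that by (intro exists_recurrent_along[OF assms(5,4,6,7) A.comm_action_axioms]) auto
    show "x \<in> closure {x0 \<in> X. \<exists>u. extraction u w \<and> recurrent_along m T u x0}"
      unfolding closure_approachable
    proof (intro allI impI)
      fix e :: real assume "e > 0"
      \<comment> \<open>The action on \<open>X\<close> is itself minimal here, so the recurrent
        point can be prescribed to lie in any given ball.\<close>
      then have "openin (top_of_set X) (X \<inter> ball x e)" "X \<inter> ball x e \<noteq> {}" using x by auto
      then obtain y where "y \<in> X \<inter> ball x e" "\<exists>u. extraction u w \<and> recurrent_along m T u y"
        using * by meson
      then show "\<exists>y\<in>{x0 \<in> X. \<exists>u. extraction u w \<and> recurrent_along m T u x0}. dist y x < e"
        by (intro bexI[of _ y]) (auto simp: dist_commute)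
    qed
  qed
  ultimately show ?thesis using Y(2) by blast
qed

end
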